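(* Let $k$ be a positive integer and let $G$ be a connected graph with $n$ vertices. Suppose that $G$ is not a $k$-clique (i.e. not isomorphic to $K_k$), and that it is not the case that $k=2$ and $G$ is a $5$-cycle. Then \[\iota(G,k) \leq \frac{n}{k+1}.\] Consequently, for any $k \geq 1$ and $n \geq 3$, \[\iota(n,k) = \iota(B_{n,k},k) = \left\lfloor \frac{n}{k+1} \right\rfloor.\]
   Context: All graphs are finite and simple. For a graph $G$ and $D \subseteq V(G)$, $N_G[D]$ denotes the closed neighbourhood $\bigcup_{v\in D}(\{v\}\cup N_G(v))$. A $k$-clique is a copy of the complete graph $K_k$. A set $D \subseteq V(G)$ is a $k$-clique isolating set of $G$ if the graph obtained from $G$ by deleting all vertices of $N_G[D]$ contains no $k$-clique; $\iota(G,k)$ denotes the minimum size of a $k$-clique isolating set of $G$. $P_m$ denotes the path with vertex set $[m]=\{1,\dots,m\}$ and edges $\{i,i+1\}$, $i\in[m-1]$; $C_5$ denotes the $5$-cycle. For $n,k\in\mathbb{N}$ with $k\neq 2$, $\iota(n,k)$ is the maximum of $\iota(G,k)$ over all connected graphs $G$ with vertex set $[n]$ that are not isomorphic to $K_k$. For $k=2$, $\iota(n,2)$ is the maximum of $\iota(G,2)$ over all connected graphs $G$ with vertex set $[n]$ that are isomorphic neither to $K_2$ nor to $C_5$. For $n,k\in\mathbb{N}$ let $a_{n,k}=\lfloor n/(k+1)\rfloor$ and $b_{n,k}=n-k\,a_{n,k}$ (so $a_{n,k}\le b_{n,k}\le a_{n,k}+k$). If $n\le k$, let $B_{n,k}=P_n$.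 If $n\ge k+1$, let $F_1,\dots,F_{a_{n,k}}$ be copies of $K_k$ such that $P_{b_{n,k}},F_1,\dots,F_{a_{n,k}}$ are pairwise vertex-disjoint, and let $B_{n,k}$ be the $n$-vertex graph obtained from $P_{b_{n,k}},F_1,\dots,F_{a_{n,k}}$ by joining, for each $i\in[a_{n,k}]$, the vertex $i$ of $P_{b_{n,k}}$ to every vertex of $F_i$. *)

theory Defs
  imports Complex_Main "Graph_Theory.Graph_Theory"
begin

text \<open>
  Finite simple graphs are the symmetric, loop-free, finite digraphs of the library
  (\<^locale>\<open>graph\<close>, or \<^locale>\<open>pair_graph\<close> when arcs are pairs of vertices): an edge
  \<open>{u,v}\<close> is the pair of arcs \<open>(u,v)\<close>, \<open>(v,u)\<close>. Note that \<^const>\<open>Digraph_Component.connected\<close>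
  requires at least one vertex, and that \<^term>\<open>complete_digraph k G\<close> says that \<open>G\<close> is
  a simple graph isomorphic to \<open>K\<^sub>k\<close>.
\<close>

definition closed_nbhd :: "('a, 'b) pre_digraph \<Rightarrow> 'a set \<Rightarrow> 'a set" where
  "closed_nbhd G D = (\<Union>v\<in>D. {v} \<union> {w. v \<rightarrow>\<^bsub>G\<^esub> w})"

definition has_clique :: "nat \<Rightarrow> ('a, 'b) pre_digraph \<Rightarrow> bool" where
  "has_clique k G \<longleftrightarrow> (\<exists>H. subgraph H G \<and> complete_digraph k H)"

definition clique_isolating :: "nat \<Rightarrow> ('a, 'b) pre_digraph \<Rightarrow> 'a set \<Rightarrow> bool" where
  "clique_isolating k G D \<longleftrightarrow>
     D \<subseteq> verts G \<and> \<not> has_clique k (G \<restriction> (verts G - closed_nbhd G D))"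

text \<open>
  For \<open>k \<ge> 1\<close> and a finite graph the minimum is over a finite set that is nonempty, since the
  whole vertex set is isolating; for \<open>k = 0\<close> no set is isolating and the value is meaningless.
\<close>

definition iota :: "('a, 'b) pre_digraph \<Rightarrow> nat \<Rightarrow> nat" where
  "iota G k = Min {card D | D. clique_isolating k G D}"

definition path_graph :: "nat \<Rightarrow> nat pair_pre_digraph" where
  "path_graph m = \<lparr> pverts = {1..m},
     parcs = {(i, j). i \<in> {1..m} \<and> j \<in> {1..m} \<and> (j = i + 1 \<or> i = j + 1)} \<rparr>"

definition C5 :: "nat pair_pre_digraph" where
  "C5 = \<lparr> pverts = {1..5}, parcs = parcs (path_graph 5) \<union> {(1, 5), (5, 1)} \<rparr>"

definition iota_max :: "nat \<Rightarrow> nat \<Rightarrow> nat" where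
  "iota_max n k = Max {iota (with_proj G) k | G :: nat pair_pre_digraph.
     pair_graph G \<and> pverts G = {1..n} \<and> Digraph_Component.connected (with_proj G) \<and>
     \<not> complete_digraph k (with_proj G) \<and>
     \<not> (k = 2 \<and> digraph_iso (with_proj G) (with_proj C5))}"

definition B_a :: "nat \<Rightarrow> nat \<Rightarrow> nat" where
  "B_a n k = n div (k + 1)"

definition B_b :: "nat \<Rightarrow> nat \<Rightarrow> nat" where
  "B_b n k = n - k * B_a n k"

text \<open>
  The cliques \<open>F\<^sub>1, \<dots>, F\<^sub>a\<close> are realised on consecutive blocks of \<open>k\<close> integers following the
  vertices \<open>1, \<dots>, b\<close> of the path, so that the vertex set of \<open>B\<^sub>n\<^sub>,\<^sub>k\<close> is \<open>{1..n}\<close>.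
\<close>

definition F_verts :: "nat \<Rightarrow> nat \<Rightarrow> nat \<Rightarrow> nat set" where
  "F_verts n k i = {B_b n k + (i - 1) * k <.. B_b n k + i * k}"

definition B_graph :: "nat \<Rightarrow> nat \<Rightarrow> nat pair_pre_digraph" where
  "B_graph n k =
    (if n \<le> k then path_graph n
     else \<lparr> pverts = {1..B_b n k} \<union> (\<Union>i\<in>{1..B_a n k}. F_verts n k i),
            parcs = parcs (path_graph (B_b n k))
              \<union> (\<Union>i\<in>{1..B_a n k}. {(u, v). u \<in> F_verts n k i \<and> v \<in> F_verts n k i \<and> u \<noteq> v}
                    \<union> {i} \<times> F_verts n k i \<union> F_verts n k i \<times> {i}) \<rparr>)"

end

theory Submission
  imports Defs
begin

text \<open>
  Induction on the order of \<open>G\<close>. If \<open>G\<close> contains a \<open>k\<close>-clique, connectivity yields a vertex \<open>v\<close>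
  of it with at least \<open>k + 1\<close> vertices in \<open>N[v]\<close>. The components of \<open>G - N[v]\<close> obey the bound
  unless they are exceptional, that is, a \<open>k\<close>-clique or, for \<open>k = 2\<close>, an induced 5-cycle.

  If some neighbour \<open>x\<close> of \<open>v\<close> is linked to two exceptional components, take \<open>v\<close>, \<open>x\<close>, one
  neighbour of \<open>v\<close> linked to each exceptional component that \<open>x\<close> misses, and one further vertex
  in each 5-cycle: the chosen neighbourhoods contain \<open>N[v]\<close> and meet every exceptional component.
  Otherwise let \<open>x\<close> be linked to its only exceptional component \<open>H\<close>, and delete \<open>H\<close> and \<open>x\<close>,
  which are dominated by few vertices of \<open>H\<close>. Only the component \<open>K\<close> of \<open>v\<close> in what remains can
  be exceptional, and then \<open>H \<union> {x} \<union> K\<close> is a small graph joined to the rest through \<open>x\<close> alone,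
  treated by hand.

  For \<open>B\<^sub>n\<^sub>,\<^sub>k\<close> every isolating set meets each of the disjoint sets \<open>{i} \<union> F\<^sub>i\<close>.
\<close>


section \<open>Cliques, components and isolation in induced subgraphs\<close>

locale adjacency =
  fixes E :: "'a \<Rightarrow> 'a \<Rightarrow> bool"
  assumes sym: "E x y \<Longrightarrow> E y x" and irrefl: "\<not> E x x"
begin

definition clique :: "nat \<Rightarrow> 'a set \<Rightarrow> bool" where
  "clique k C \<longleftrightarrow> finite C \<and> card C = k \<and> (\<forall>x\<in>C. \<forall>y\<in>C. x \<noteq> y \<longrightarrow> E x y)"

definition clique_free :: "nat \<Rightarrow> 'a set \<Rightarrow> bool" where
  "clique_free k U \<longleftrightarrow> (\<forall>C\<subseteq>U. \<not> clique k C)"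

text \<open>
  Closed neighbourhoods and edges live on the whole type; a vertex set \<open>S\<close> stands for the
  subgraph it induces.
\<close>

definition nb :: "'a set \<Rightarrow> 'a set" where
  "nb D = {w. \<exists>v\<in>D. w = v \<or> E v w}"

text \<open>The bound for the subgraph induced by \<open>S\<close>, expressed by the existence of a
  small isolating set and with the division by \<open>k + 1\<close> cleared.\<close>

definition good :: "nat \<Rightarrow> 'a set \<Rightarrow> bool" where
  "good k S \<longleftrightarrow> (\<exists>D\<subseteq>S. clique_free k (S - nb D) \<and> (k + 1) * card D \<le> card S)"

text \<open>Connectivity is encoded by cuts instead of walks, because the proof uses it to obtain
  edges that leave a given set.\<close>

definition conn :: "'a set \<Rightarrow> bool" where
  "conn S \<longleftrightarrow> S \<noteq> {} \<and> (\<forall>A\<subseteq>S. A \<noteq> {} \<longrightarrow> A \<noteq> S \<longrightarrow> (\<exists>a\<in>A. \<exists>b\<in>S - A. E a b))"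

text \<open>The five non-edges exclude chords: a 5-cycle with a chord obeys the bound and must not
  count as exceptional.\<close>

definition cyc5 :: "'a \<Rightarrow> 'a \<Rightarrow> 'a \<Rightarrow> 'a \<Rightarrow> 'a \<Rightarrow> bool" where
  "cyc5 a b c d e \<longleftrightarrow> distinct [a, b, c, d, e] \<and>
     E a b \<and> E b c \<and> E c d \<and> E d e \<and> E e a \<and>
     \<not> E a c \<and> \<not> E b d \<and> \<not> E c e \<and> \<not> E d a \<and> \<not> E e b"

definition exceptional :: "nat \<Rightarrow> 'a set \<Rightarrow> bool" where
  "exceptional k S \<longleftrightarrow> clique k S \<or> k = 2 \<and> (\<exists>a b c d e. S = {a, b, c, d, e} \<and> cyc5 a b c d e)"

definition components :: "'a set \<Rightarrow> 'a set set \<Rightarrow> bool" where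
  "components S P \<longleftrightarrow> \<Union>P = S \<and> (\<forall>B\<in>P. conn B) \<and>
     (\<forall>B\<in>P. \<forall>B'\<in>P. B \<noteq> B' \<longrightarrow> B \<inter> B' = {} \<and> (\<forall>x\<in>B. \<forall>y\<in>B'. \<not> E x y))"

lemma sym_iff: "E x y \<longleftrightarrow> E y x"
  using sym by blast

lemma nb_Un [simp]: "nb (A \<union> B) = nb A \<union> nb B"
  by (auto simp: nb_def)

lemma in_nb_sing: "w \<in> nb {v} \<longleftrightarrow> w = v \<or> E v w"
  by (auto simp: nb_def)

lemma in_nb_insert: "w \<in> nb (insert v D) \<longleftrightarrow> w = v \<or> E v w \<or> w \<in> nb D"
  by (auto simp: nb_def)

lemma nb_empty [simp]: "nb {} = {}"
  by (auto simp: nb_def)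

lemma nb_mono: "A \<subseteq> B \<Longrightarrow> nb A \<subseteq> nb B"
  by (auto simp: nb_def)

lemma subset_nb: "A \<subseteq> nb A"
  by (auto simp: nb_def)

lemma clique_free_mono: "clique_free k U \<Longrightarrow> V \<subseteq> U \<Longrightarrow> clique_free k V"
  unfolding clique_free_def by blast

lemma clique_free_card: "finite U \<Longrightarrow> card U < k \<Longrightarrow> clique_free k U"
  unfolding clique_free_def clique_def using card_mono leD by metis

lemma clique_free_2: "(\<And>x y. x \<in> U \<Longrightarrow> y \<in> U \<Longrightarrow> \<not> E x y) \<Longrightarrow> clique_free 2 U"
  unfolding clique_free_def clique_def by (auto simp: card_2_iff)

text \<open>A clique contained in neither set has a vertex outside each of them, and these two would
  be joined by an edge between the sets.\<close>

lemma clique_free_Un: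
  assumes "clique_free k A" "clique_free k B" "\<And>a b. a \<in> A \<Longrightarrow> b \<in> B \<Longrightarrow> \<not> E a b"
  shows "clique_free k (A \<union> B)"
  unfolding clique_free_def
proof (intro allI impI notI)
  fix C assume C: "C \<subseteq> A \<union> B" "clique k C"
  then obtain a b where ab: "a \<in> C" "a \<notin> A" "b \<in> C" "b \<notin> B"
    using assms(1,2) unfolding clique_free_def by blast
  then have "b \<in> A" "a \<in> B" "a \<noteq> b" using C(1) by auto
  moreover from this have "E b a" using C(2) ab unfolding clique_def by simp
  ultimately show False using assms(3) by simp
qed

lemma clique_free_Union:
  assumes "k \<ge> 1" "\<And>B. B \<in> P \<Longrightarrow> clique_free k (f B)"
    "\<And>B B' x y. B \<in> P \<Longrightarrow> B' \<in> P \<Longrightarrow> B \<noteq> B' \<Longrightarrow> x \<in> f B \<Longrightarrow> y \<in> f B' \<Longrightarrow> \<not> E x y"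
  shows "clique_free k (\<Union>B\<in>P. f B)"
  unfolding clique_free_def
proof (intro allI impI notI)
  fix C assume C: "C \<subseteq> (\<Union>B\<in>P. f B)" "clique k C"
  then obtain x where "x \<in> C" using assms(1) unfolding clique_def by fastforce
  then obtain B where B: "B \<in> P" "x \<in> f B" using C by blast
  have "C \<subseteq> f B"
  proof
    fix y assume y: "y \<in> C"
    then obtain B' where "B' \<in> P" "y \<in> f B'" using C by blast
    then show "y \<in> f B"
      using assms(3)[OF B(1) \<open>B' \<in> P\<close> _ B(2) \<open>y \<in> f B'\<close>] C(2) y \<open>x \<in> C\<close> B unfolding clique_def by metis
  qed
  then show False using assms(2)[OF B(1)] C(2) unfolding clique_free_def by blast
qed

section \<open>Connected sets and component partitions\<close>

lemma conn_cut:
  assumes "conn T" "a \<in> T" "a \<in> U" "b \<in> T" "b \<notin> U"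
  shows "\<exists>a\<in>T \<inter> U. \<exists>b\<in>T - U. E a b"
proof -
  have "T \<inter> U \<subseteq> T" "T \<inter> U \<noteq> {}" "T \<inter> U \<noteq> T" using assms by auto
  then have "\<exists>a\<in>T \<inter> U. \<exists>b\<in>T - T \<inter> U. E a b"
    using assms(1) unfolding conn_def by simp
  then show ?thesis by blast
qed

text \<open>A cut either separates \<open>A\<close> or \<open>B\<close>, and connectivity of that
  set yields the edge, or it contains one of them and misses the other, and then the edge
  \<open>a b\<close> crosses it.\<close>

lemma conn_Un:
  assumes "conn A" "conn B" "a \<in> A" "b \<in> B" "E a b"
  shows "conn (A \<union> B)"
  unfolding conn_def
proof (intro conjI allI impI)
  show "A \<union> B \<noteq> {}" using assms(3) by blast
  fix U assume U: "U \<subseteq> A \<union> B" "U \<noteq> {}" "U \<noteq> A \<union> B"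
  have sub: "\<exists>a\<in>U. \<exists>b\<in>A \<union> B - U. E a b" if "conn T" "T \<subseteq> A \<union> B" "T \<inter> U \<noteq> {}" "\<not> T \<subseteq> U" for T
    using that conn_cut[OF that(1), of _ U] by blast
  show "\<exists>a\<in>U. \<exists>b\<in>A \<union> B - U. E a b"
  proof (cases "(A \<inter> U \<noteq> {} \<and> \<not> A \<subseteq> U) \<or> (B \<inter> U \<noteq> {} \<and> \<not> B \<subseteq> U)")
    case True
    then show ?thesis using sub assms(1,2) by blast
  next
    case False
    then consider "A \<subseteq> U" "B \<inter> U = {}" | "B \<subseteq> U" "A \<inter> U = {}" using U by blast
    then show ?thesis using assms(3-5) sym by cases blast+
  qed
qed

lemma conn_singleton: "conn {x}"
  unfolding conn_def by blast

lemma conn_clique: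
  assumes "\<And>x y. x \<in> C \<Longrightarrow> y \<in> C \<Longrightarrow> x \<noteq> y \<Longrightarrow> E x y" "C \<noteq> {}"
  shows "conn C"
  unfolding conn_def
proof (intro conjI allI impI)
  fix A assume A: "A \<subseteq> C" "A \<noteq> {}" "A \<noteq> C"
  then obtain a b where "a \<in> A" "b \<in> C - A" by blast
  then show "\<exists>a\<in>A. \<exists>b\<in>C - A. E a b" using assms(1)[of a b] A by blast
qed fact

lemma conn_attach:
  assumes "conn A" "finite Q" "\<And>B. B \<in> Q \<Longrightarrow> conn B \<and> (\<exists>a\<in>A. \<exists>b\<in>B. E a b)"
  shows "conn (A \<union> \<Union>Q)"
  using assms(2,3)
proof (induction Q rule: finite_induct)
  case empty
  then show ?case using assms(1) by simp
next
  case (insert B Q)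
  then obtain a b where "a \<in> A" "b \<in> B" "E a b" "conn B" by blast
  then have "conn ((A \<union> \<Union>Q) \<union> B)" using insert conn_Un[of "A \<union> \<Union>Q" B a b] by blast
  then show ?case by (simp add: Un_commute Un_left_commute)
qed

lemma conn_subset_component:
  assumes "components S P" "conn T" "T \<subseteq> S" "B \<in> P" "B \<inter> T \<noteq> {}"
  shows "T \<subseteq> B"
proof (rule ccontr)
  assume "\<not> T \<subseteq> B"
  then obtain a b where ab: "a \<in> T \<inter> B" "b \<in> T - B" "E a b"
    using assms(5) conn_cut[OF assms(2), of _ B] by blast
  then obtain B' where "B' \<in> P" "b \<in> B'" using assms(1,3) unfolding components_def by blast
  moreover from this have "B' \<noteq> B" using ab by blast
  ultimately show False using ab assms(1,4) unfolding components_def by blast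
qed

text \<open>Induction on the set: if it is not connected, it splits into two smaller parts without
  edges between them, whose partitions are combined.\<close>

lemma components_exist: "finite S \<Longrightarrow> \<exists>P. components S P"
proof (induction S rule: finite_psubset_induct)
  case (psubset S)
  show ?case
  proof (cases "S = {} \<or> conn S")
    case True
    then show ?thesis
    proof
      assume "S = {}"
      then have "components S {}" unfolding components_def by simp
      then show ?thesis ..
    next
      assume "conn S"
      then have "components S {S}" unfolding components_def by simp
      then show ?thesis ..
    qed
  next
    case False
    then obtain A where A: "A \<subseteq> S" "A \<noteq> {}" "A \<noteq> S" "\<And>a b. a \<in> A \<Longrightarrow> b \<in> S - A \<Longrightarrow> \<not> E a b"
      unfolding conn_def by blast
    then obtain P Q where PQ: "components A P" "components (S - A) Q"
      using psubset.IH[of A] psubset.IH[of "S - A"] by blast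
    have U: "\<Union>P = A" "\<Union>Q = S - A" using PQ unfolding components_def by simp_all
    then have sub: "B \<subseteq> A" "B' \<subseteq> S - A" if "B \<in> P" "B' \<in> Q" for B B'
      using that by auto
    have "B \<inter> B' = {} \<and> (\<forall>x\<in>B. \<forall>y\<in>B'. \<not> E x y)" if "B \<in> P" "B' \<in> Q" for B B'
      using sub[OF that] A(4) by blast
    moreover from this have "B' \<inter> B = {} \<and> (\<forall>x\<in>B'. \<forall>y\<in>B. \<not> E x y)" if "B \<in> P" "B' \<in> Q" for B B'
      using that sym by blast
    moreover have "\<Union>(P \<union> Q) = S" using U A(1) by auto
    ultimately have "components S (P \<union> Q)" using PQ unfolding components_def by (simp add: ball_Un)
    then show ?thesis ..
  qed
qed

lemma finite_comps: "components S P \<Longrightarrow> finite S \<Longrightarrow> finite P \<and> (\<forall>B\<in>P. finite B)"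
  unfolding components_def by (meson Union_upper finite_UnionD finite_subset)

lemma components_subset: "components S P \<Longrightarrow> B \<in> P \<Longrightarrow> B \<subseteq> S \<and> B \<noteq> {}"
  unfolding components_def conn_def by blast

lemma components_disjoint: "components S P \<Longrightarrow> B \<in> P \<Longrightarrow> B' \<in> P \<Longrightarrow> x \<in> B \<Longrightarrow> x \<in> B' \<Longrightarrow> B = B'"
  unfolding components_def by blast

lemma components_no_edge:
  "components S P \<Longrightarrow> B \<in> P \<Longrightarrow> B' \<in> P \<Longrightarrow> B \<noteq> B' \<Longrightarrow> x \<in> B \<Longrightarrow> y \<in> B' \<Longrightarrow> \<not> E x y"
  unfolding components_def by blast

lemma components_Union: "components S P \<Longrightarrow> \<Union>P = S"
  unfolding components_def by simp

lemma components_conn: "components S P \<Longrightarrow> B \<in> P \<Longrightarrow> conn B"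
  unfolding components_def by simp

lemma components_sub: "components S P \<Longrightarrow> Q \<subseteq> P \<Longrightarrow> components (\<Union>Q) Q"
  unfolding components_def by blast

lemma components_card: "components S P \<Longrightarrow> finite S \<Longrightarrow> card S = (\<Sum>B\<in>P. card B)"
  using finite_comps[of S P] card_Union_disjoint[of P]
  by (auto simp: components_def pairwise_def disjnt_def)

section \<open>Assembling small isolating sets\<close>

lemma good_Union:
  assumes k: "k \<ge> 1" and fin: "finite S" and P: "components S P" and g: "\<And>B. B \<in> P \<Longrightarrow> good k B"
  shows "good k S"
proof -
  obtain d where d: "\<And>B. B \<in> P \<Longrightarrow> d B \<subseteq> B \<and> clique_free k (B - nb (d B)) \<and> (k + 1) * card (d B) \<le> card B"
    using g unfolding good_def by metis
  let ?D = "\<Union>B\<in>P. d B"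
  have "finite P" using finite_comps P fin by blast
  then have "(k + 1) * card ?D \<le> (k + 1) * (\<Sum>B\<in>P. card (d B))"
    by (intro mult_left_mono card_UN_le) auto
  also have "\<dots> = (\<Sum>B\<in>P. (k + 1) * card (d B))" by (rule sum_distrib_left)
  also have "\<dots> \<le> (\<Sum>B\<in>P. card B)" by (intro sum_mono) (use d in blast)
  also have "\<dots> = card S" using components_card P fin by simp
  finally have "(k + 1) * card ?D \<le> card S" .
  moreover have "?D \<subseteq> S" using d P components_subset by fast
  moreover have "clique_free k (S - nb ?D)"
  proof (rule clique_free_mono[OF clique_free_Union[OF k]])
    show "clique_free k (B - nb (d B))" if "B \<in> P" for B using d that by blast
    show "\<not> E x y" if "B \<in> P" "B' \<in> P" "B \<noteq> B'" "x \<in> B - nb (d B)" "y \<in> B' - nb (d B')" for B B' x y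
      using components_no_edge[OF P, of B B'] that by blast
    show "S - nb ?D \<subseteq> (\<Union>B\<in>P. B - nb (d B))"
    proof
      fix w assume w: "w \<in> S - nb ?D"
      then obtain B where "B \<in> P" "w \<in> B" using P unfolding components_def by blast
      moreover from this have "nb (d B) \<subseteq> nb ?D" by (intro nb_mono) blast
      ultimately show "w \<in> (\<Union>B\<in>P. B - nb (d B))" using w by blast
    qed
  qed
  ultimately show ?thesis unfolding good_def by blast
qed

text \<open>The reduction used throughout the induction: delete \<open>W\<close>, which pays for
  \<open>D\<close>. The undominated rest of \<open>W\<close> may stay as long as it is clique-free
  and has no edge to \<open>S - W\<close>, since then no clique uses vertices of both sides.\<close>

lemma good_split:
  assumes "finite S" "W \<subseteq> S" "D \<subseteq> W" "(k + 1) * card D \<le> card W"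
    "clique_free k (W - nb D)" "\<And>a b. a \<in> W - nb D \<Longrightarrow> b \<in> S - W \<Longrightarrow> \<not> E a b" "good k (S - W)"
  shows "good k S"
proof -
  obtain D' where D': "D' \<subseteq> S - W" "clique_free k (S - W - nb D')" "(k + 1) * card D' \<le> card (S - W)"
    using assms(7) unfolding good_def by blast
  have "clique_free k ((W - nb D) \<union> (S - W - nb D'))"
    by (rule clique_free_Un) (use assms D' in auto)
  then have "clique_free k (S - nb (D \<union> D'))" by (rule clique_free_mono) auto
  moreover have "(k + 1) * card (D \<union> D') \<le> card S"
  proof -
    have "(k + 1) * card (D \<union> D') \<le> (k + 1) * (card D + card D')"
      by (intro mult_left_mono card_Un_le) auto
    also have "\<dots> \<le> card W + card (S - W)" using assms(4) D'(3) by (simp add: algebra_simps)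
    also have "\<dots> = card S"
      using assms(1,2) card_mono[of S W] by (subst card_Diff_subset) (auto dest: finite_subset)
    finally show ?thesis .
  qed
  moreover have "D \<union> D' \<subseteq> S" using assms(2,3) D'(1) by auto
  ultimately show ?thesis unfolding good_def by (intro exI[of _ "D \<union> D'"]) simp
qed

section \<open>Exceptional sets\<close>

lemma cyc5_rotate: "cyc5 a b c d e \<Longrightarrow> cyc5 b c d e a"
  unfolding cyc5_def by auto

lemma cyc5_at:
  assumes "cyc5 a b c d e" "y \<in> {a, b, c, d, e}"
  shows "\<exists>b' c' d' e'. {a, b, c, d, e} = {y, b', c', d', e'} \<and> cyc5 y b' c' d' e'"
proof -
  note r = cyc5_rotate
  have 1: "cyc5 b c d e a" using assms r by blast
  have 2: "cyc5 c d e a b" using 1 r by blast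
  have 3: "cyc5 d e a b c" using 2 r by blast
  have 4: "cyc5 e a b c d" using 3 r by blast
  consider "y = a" | "y = b" | "y = c" | "y = d" | "y = e" using assms(2) by blast
  then show ?thesis
  proof cases
    case 1 then show ?thesis using assms(1) by blast
  next
    case 2
    then have "{a, b, c, d, e} = {y, c, d, e, a}" by auto
    then show ?thesis using 1 2 by blast
  next
    case 3
    then have "{a, b, c, d, e} = {y, d, e, a, b}" by auto
    then show ?thesis using \<open>cyc5 c d e a b\<close> 3 by blast
  next
    case 4
    then have "{a, b, c, d, e} = {y, e, a, b, c}" by auto
    then show ?thesis using \<open>cyc5 d e a b c\<close> 4 by blast
  next
    case 5
    then have "{a, b, c, d, e} = {y, a, b, c, d}" by auto
    then show ?thesis using \<open>cyc5 e a b c d\<close> 5 by blast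
  qed
qed

lemma exceptional_cases:
  assumes "exceptional k H" "y \<in> H"
  obtains "clique k H" | b c d e where "k = 2" "H = {y, b, c, d, e}" "cyc5 y b c d e"
  using assms cyc5_at unfolding exceptional_def by metis

lemma cyc5_facts:
  assumes "cyc5 a b c d e"
  shows "card {a, b, c, d, e} = 5" "distinct [a, b, c, d, e]"
    "E a b" "E b a" "E b c" "E c b" "E c d" "E d c" "E d e" "E e d" "E e a" "E a e"
    "\<not> E a c" "\<not> E c a" "\<not> E b d" "\<not> E d b" "\<not> E c e" "\<not> E e c" "\<not> E d a" "\<not> E a d" "\<not> E e b" "\<not> E b e"
  using assms sym_iff unfolding cyc5_def by auto

text \<open>When \<open>y\<close> is dominated from outside, a clique loses a vertex and needs
  nothing more, while in the 5-cycle \<open>y b c d e\<close> the single vertex \<open>c\<close>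
  leaves only \<open>e\<close>. In both cases \<open>k\<close> vertices of \<open>H\<close> remain
  unspent; they pay for vertices chosen outside \<open>H\<close>.\<close>

lemma exceptional_hit:
  assumes "exceptional k H" "y \<in> H" "k \<ge> 1"
  shows "\<exists>e\<subseteq>H. card H = k + (k + 1) * card e \<and> clique_free k (H - {y} - nb e)"
  using assms(1,2)
proof (cases rule: exceptional_cases)
  case 1
  then have "clique_free k (H - {y})"
    using assms by (intro clique_free_card) (auto simp: clique_def)
  then show ?thesis using 1 by (intro exI[of _ "{}"]) (auto simp: clique_def)
next
  case (2 b c d e)
  note f = cyc5_facts[OF 2(3)]
  have "clique_free k (H - {y} - nb {c})"
    using 2 f irrefl by (auto intro!: clique_free_2 simp: in_nb_sing)
  then show ?thesis using 2 f(1) by (intro exI[of _ "{c}"]) auto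
qed

text \<open>Meant for \<open>H\<close> together with one outside neighbour of \<open>y\<close>: that
  vertex is dominated because \<open>y\<close> is in \<open>D\<close>, and it supplies the extra 1
  in the bound. A clique takes \<open>{y}\<close>, a 5-cycle \<open>{y, c}\<close> with
  \<open>3 * 2 = 5 + 1\<close>.\<close>

lemma exceptional_cover:
  assumes "exceptional k H" "y \<in> H"
  shows "\<exists>D\<subseteq>H. y \<in> D \<and> H \<subseteq> nb D \<and> (k + 1) * card D \<le> card H + 1"
  using assms(1,2)
proof (cases rule: exceptional_cases)
  case 1
  then show ?thesis using assms by (intro exI[of _ "{y}"]) (auto simp: clique_def nb_def)
next
  case (2 b c d e)
  note f = cyc5_facts[OF 2(3)]
  have "H \<subseteq> nb {y, c}" using 2 f by (auto simp: in_nb_insert)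
  then show ?thesis using 2 f(1,2) by (intro exI[of _ "{y, c}"]) auto
qed

lemma exceptional_finite: "exceptional k H \<Longrightarrow> finite H"
  unfolding exceptional_def clique_def by auto

section \<open>The bound for connected graphs\<close>

text \<open>Each vertex of \<open>X\<close> costs \<open>k + 1\<close>: 1 is charged to
  \<open>N[v]\<close> and \<open>k\<close> to an exceptional component. This requires
  \<open>X\<close> to have at most as many vertices as there are exceptional components, which holds
  because the single vertex \<open>x\<close> serves at least two of them and so makes room for
  \<open>v\<close>.\<close>

lemma good_two_exceptional:
  assumes k: "k \<ge> 1" and fin: "finite S" and v: "v \<in> S" and P: "components (S - nb {v}) P"
    and x: "x \<in> S" "E v x"
    and H12: "H1 \<in> P" "H2 \<in> P" "H1 \<noteq> H2" "exceptional k H1" "exceptional k H2" "\<exists>y\<in>H1. E x y" "\<exists>y\<in>H2. E x y"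
    and lnk: "\<And>H. H \<in> P \<Longrightarrow> \<exists>x'\<in>S. E v x' \<and> (\<exists>y\<in>H. E x' y)"
    and gd: "\<And>H. H \<in> P \<Longrightarrow> \<not> exceptional k H \<Longrightarrow> good k H"
  shows "good k S"
proof -
  define P' where "P' = {H \<in> P. exceptional k H}"
  define L where "L = {H \<in> P'. \<exists>y\<in>H. E x y}"
  have finP: "finite P" using finite_comps[OF P] fin by auto
  then have finP': "finite P'" and finL: "finite L" unfolding L_def P'_def by auto
  \<comment> \<open>All exceptional components linked to \<open>x\<close> are assigned
    \<open>x\<close> itself, so that only those outside \<open>L\<close> add new vertices to
    \<open>X\<close>.\<close>
  have "\<exists>x'. x' \<in> S \<and> E v x' \<and> (\<exists>y\<in>H. E x' y) \<and> (H \<in> L \<longrightarrow> x' = x)" if "H \<in> P'" for H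
    using lnk[of H] that x unfolding L_def P'_def by blast
  then obtain f where f: "\<And>H. H \<in> P' \<Longrightarrow> f H \<in> S \<and> E v (f H) \<and> (\<exists>y\<in>H. E (f H) y) \<and> (H \<in> L \<longrightarrow> f H = x)"
    by metis
  then obtain y where y: "\<And>H. H \<in> P' \<Longrightarrow> y H \<in> H \<and> E (f H) (y H)" by metis
  have "\<exists>e\<subseteq>H. card H = k + (k + 1) * card e \<and> clique_free k (H - {y H} - nb e)" if "H \<in> P'" for H
    using exceptional_hit[OF _ _ k] y that unfolding P'_def by blast
  then obtain e where e: "\<And>H. H \<in> P' \<Longrightarrow> e H \<subseteq> H \<and> card H = k + (k + 1) * card (e H) \<and> clique_free k (H - {y H} - nb (e H))"
    by metis
  define X where "X = {v, x} \<union> f ` (P' - L)"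
  define D where "D = X \<union> (\<Union>H\<in>P'. e H)"
  define W where "W = (S \<inter> nb {v}) \<union> \<Union>P'"
  have subP: "H \<subseteq> S - nb {v}" if "H \<in> P" for H using components_subset[OF P that] by blast
  have Xsub: "X \<subseteq> S \<inter> nb {v}" unfolding X_def using v x f by (auto simp: in_nb_sing)
  have "P' \<subseteq> P" unfolding P'_def by blast
  have cardUP': "card (\<Union>P') = (\<Sum>H\<in>P'. card H)"
    using components_card[OF components_sub[OF P \<open>P' \<subseteq> P\<close>]] finP' exceptional_finite unfolding P'_def by blast
  have finUP': "finite (\<Union>P')" using finP' exceptional_finite unfolding P'_def by blast
  have "{H1, H2} \<subseteq> L" using H12 unfolding L_def P'_def by blast
  then have "2 \<le> card L" using H12(3) card_mono[OF finL, of "{H1, H2}"] by simp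
  have mX: "card X \<le> card P'"
  proof -
    have "card X \<le> card {v, x} + card (f ` (P' - L))" unfolding X_def by (rule card_Un_le)
    also have "\<dots> \<le> 2 + card (P' - L)"
      using card_image_le[of "P' - L" f] finP' by (intro add_mono) (auto simp: card_insert_if)
    also have "\<dots> \<le> card L + card (P' - L)" using \<open>2 \<le> card L\<close> by simp
    also have "\<dots> = card P'"
      using finP' finL card_mono[OF finP', of L] by (subst card_Diff_subset) (auto simp: L_def)
    finally show ?thesis .
  qed
  have mX': "card X \<le> card (S \<inter> nb {v})" using Xsub fin by (intro card_mono) auto
  have "card D \<le> card X + (\<Sum>H\<in>P'. card (e H))"
    unfolding D_def using card_Un_le[of X "\<Union>H\<in>P'. e H"] card_UN_le[OF finP', of e] by linarith
  then have "(k + 1) * card D \<le> (k + 1) * (card X + (\<Sum>H\<in>P'. card (e H)))"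
    by (rule mult_left_mono) simp
  also have "\<dots> = card X + k * card X + (\<Sum>H\<in>P'. (k + 1) * card (e H))"
    by (simp add: algebra_simps sum_distrib_left)
  also have "\<dots> \<le> card (S \<inter> nb {v}) + k * card P' + (\<Sum>H\<in>P'. (k + 1) * card (e H))"
    using mX mX' by (intro add_mono mult_left_mono) auto
  also have "\<dots> = card (S \<inter> nb {v}) + (\<Sum>H\<in>P'. k + (k + 1) * card (e H))"
    by (simp add: sum.distrib)
  also have "\<dots> = card (S \<inter> nb {v}) + card (\<Union>P')"
    using e by (simp add: cardUP')
  also have "\<dots> = card W"
    unfolding W_def using fin finUP' subP \<open>P' \<subseteq> P\<close> by (subst card_Un_disjoint) auto
  finally have cardD: "(k + 1) * card D \<le> card W" .
  \<comment> \<open>\<open>v\<close> dominates \<open>N[v]\<close>, and in each exceptional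
    component \<open>f H\<close> dominates \<open>y H\<close>; what survives lies in the clique-free
    remainders supplied by \<open>exceptional_hit\<close>.\<close>
  have WD: "W - nb D \<subseteq> (\<Union>H\<in>P'. H - {y H} - nb (e H))"
  proof
    fix w assume w: "w \<in> W - nb D"
    have "v \<in> D" unfolding D_def X_def by blast
    then have "w \<notin> nb {v}" using w nb_mono[of "{v}" D] by blast
    then obtain H where H: "H \<in> P'" "w \<in> H" using w unfolding W_def by blast
    have "f H \<in> D" unfolding D_def X_def using f[OF H(1)] H(1) by blast
    then have "y H \<in> nb D" using y[OF H(1)] unfolding nb_def by blast
    moreover have "nb (e H) \<subseteq> nb D" by (rule nb_mono) (use H(1) D_def in blast)
    ultimately show "w \<in> (\<Union>H\<in>P'. H - {y H} - nb (e H))" using H w by blast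
  qed
  have SW: "S - W = \<Union>(P - P')"
  proof
    show "S - W \<subseteq> \<Union>(P - P')" using components_Union[OF P] unfolding W_def by auto
    show "\<Union>(P - P') \<subseteq> S - W"
    proof
      fix z assume "z \<in> \<Union>(P - P')"
      then obtain B where B: "B \<in> P" "B \<notin> P'" "z \<in> B" by blast
      then have "z \<notin> \<Union>P'" using components_disjoint[OF P] \<open>P' \<subseteq> P\<close> by blast
      then show "z \<in> S - W" using subP[OF B(1)] B(3) unfolding W_def by blast
    qed
  qed
  show ?thesis
  proof (rule good_split[OF fin _ _ cardD])
    show "W \<subseteq> S" unfolding W_def using subP \<open>P' \<subseteq> P\<close> by blast
    show "D \<subseteq> W" unfolding D_def W_def using Xsub e by blast
    show "clique_free k (W - nb D)"
    proof (rule clique_free_mono[OF clique_free_Union[OF k] WD])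
      show "clique_free k (H - {y H} - nb (e H))" if "H \<in> P'" for H using e that by blast
      show "\<not> E a b" if "B \<in> P'" "B' \<in> P'" "B \<noteq> B'" "a \<in> B - {y B} - nb (e B)" "b \<in> B' - {y B'} - nb (e B')" for B B' a b
        using components_no_edge[OF P, of B B'] that \<open>P' \<subseteq> P\<close> by blast
    qed
    show "\<not> E a b" if "a \<in> W - nb D" "b \<in> S - W" for a b
    proof -
      obtain B where "B \<in> P'" "a \<in> B" using subsetD[OF WD \<open>a \<in> W - nb D\<close>] by blast
      moreover obtain B' where "B' \<in> P - P'" "b \<in> B'" using \<open>b \<in> S - W\<close> unfolding SW by blast
      ultimately show ?thesis using components_no_edge[OF P, of B B'] \<open>P' \<subseteq> P\<close> by blast
    qed
    show "good k (S - W)"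
      unfolding SW
    proof (rule good_Union[OF k _ components_sub[OF P]])
      show "finite (\<Union>(P - P'))" using fin SW by (metis finite_Diff)
      show "good k B" if "B \<in> P - P'" for B using gd that unfolding P'_def by blast
    qed blast
  qed
qed

lemma good_via_free:
  assumes "finite S" "D \<subseteq> S" "clique_free k (S - nb D)" "(k + 1) * card D \<le> card S"
  shows "good k S"
  unfolding good_def using assms(2-4) by blast

text \<open>\<open>uniq\<close> says that no neighbour of \<open>v\<close> is linked to two
  exceptional components. Hence, after the deletion of \<open>H\<close> and \<open>x\<close>, every
  component other than that of \<open>v\<close> is an old component linked to \<open>x\<close>, and
  so is not exceptional.\<close>

lemma good_unique_exceptional:
  assumes k: "k \<ge> 1" and fin: "finite S" and con: "conn S" and nexc: "\<not> exceptional k S"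
    and IH: "\<And>T. T \<subset> S \<Longrightarrow> conn T \<Longrightarrow> \<not> exceptional k T \<Longrightarrow> good k T"
    and v: "v \<in> S" and P: "components (S - nb {v}) P"
    and H: "H \<in> P" "exceptional k H" and x: "x \<in> S" "E v x" and y: "y \<in> H" "E x y"
    and uniq: "\<And>x' H1 H2 y1 y2. x' \<in> S \<Longrightarrow> E v x' \<Longrightarrow> H1 \<in> P \<Longrightarrow> H2 \<in> P \<Longrightarrow>
       exceptional k H1 \<Longrightarrow> exceptional k H2 \<Longrightarrow> y1 \<in> H1 \<Longrightarrow> E x' y1 \<Longrightarrow> y2 \<in> H2 \<Longrightarrow> E x' y2 \<Longrightarrow> H1 = H2"
  shows "good k S"
proof -
  have HS: "H \<subseteq> S" "H \<inter> nb {v} = {}" using components_subset[OF P H(1)] by auto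
  have finH: "finite H" using H(2) by (rule exceptional_finite)
  have xH: "x \<notin> H" and vH: "v \<notin> H" and xv: "x \<noteq> v"
    using HS(2) x irrefl by (auto simp: nb_def)
  define X where "X = insert x H"
  have XS: "X \<subseteq> S" unfolding X_def using x HS by simp
  have cardX: "card X = card H + 1" unfolding X_def using xH finH by simp
  obtain R where R: "components (S - X) R" using components_exist fin by blast
  have "v \<in> S - X" unfolding X_def using v vH xv by simp
  then obtain K where K: "K \<in> R" "v \<in> K" using components_Union[OF R] by blast
  have KS: "K \<subseteq> S" "x \<notin> K" "K \<inter> H = {}" using components_subset[OF R K(1)] unfolding X_def by auto
  then have finK: "finite K" using fin finite_subset by blast
  \<comment> \<open>\<open>H\<close> avoids \<open>N[v]\<close>, so every neighbour of
    \<open>v\<close> other than \<open>x\<close> survives the deletion and stays in the component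
    \<open>K\<close> of \<open>v\<close>.\<close>
  have nvK: "u \<in> K" if "u \<in> S" "E v u" "u \<noteq> x" for u
  proof -
    have "u \<notin> H" using HS(2) that(2) by (auto simp: nb_def)
    then have "u \<in> S - X" using that unfolding X_def by simp
    then obtain B where "B \<in> R" "u \<in> B" using components_Union[OF R] by blast
    then show ?thesis using components_no_edge[OF R K(1) _ _ K(2)] that(2) by blast
  qed
  \<comment> \<open>The component of \<open>S - N[v]\<close> around such a \<open>B\<close> misses
    both \<open>x\<close> and \<open>H\<close>, so it lies in \<open>S - X\<close> and cannot be
    larger than \<open>B\<close>.\<close>
  have blockP: "B \<in> P" if B: "B \<in> R" "B \<inter> nb {v} = {}" for B
  proof -
    have sub: "B \<subseteq> S - nb {v}" "B \<inter> H = {}" "B \<noteq> {}" using components_subset[OF R B(1)] B(2) unfolding X_def by auto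
    then obtain b H2 where b: "b \<in> B" "H2 \<in> P" "b \<in> H2" using components_Union[OF P] by blast
    then have "B \<subseteq> H2"
      using conn_subset_component[OF P components_conn[OF R B(1)] sub(1), of H2] by blast
    have "H2 \<noteq> H" using b sub by blast
    then have "H2 \<inter> H = {}" using components_disjoint[OF P b(2) H(1)] by blast
    moreover have "x \<notin> H2" using components_subset[OF P b(2)] x by (auto simp: nb_def)
    ultimately have "H2 \<subseteq> S - X" using components_subset[OF P b(2)] unfolding X_def by blast
    then have "H2 \<subseteq> B"
      using conn_subset_component[OF R components_conn[OF P b(2)] _ B(1)] b by blast
    then show ?thesis using \<open>B \<subseteq> H2\<close> b(2) by simp
  qed
  have otherP: "B \<in> P" "B \<noteq> H" if B: "B \<in> R" "B \<noteq> K" for B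
  proof -
    have "B \<inter> K = {}" "x \<notin> B" using components_disjoint[OF R B(1) K(1)] B components_subset[OF R B(1)] unfolding X_def by auto
    then have "B \<inter> nb {v} = {}" using nvK K(2) components_subset[OF R B(1)] by (auto simp: nb_def)
    then show "B \<in> P" using blockP B(1) by blast
    show "B \<noteq> H" using components_subset[OF R B(1)] unfolding X_def by auto
  qed
  \<comment> \<open>\<open>B\<close> is a component both of \<open>S - X\<close> and of
    \<open>S - N[v]\<close>; the former rules out edges to the rest of \<open>S - X\<close>, the
    latter edges to \<open>H\<close>.\<close>
  have out: "a \<in> B \<Longrightarrow> b \<in> S - B \<Longrightarrow> E a b \<Longrightarrow> b = x" if B: "B \<in> R" "B \<noteq> K" for B a b
  proof -
    assume ab: "a \<in> B" "b \<in> S - B" "E a b"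
    show "b = x"
    proof (rule ccontr)
      assume "b \<noteq> x"
      then consider "b \<in> H" | "b \<in> S - X" using ab(2) unfolding X_def by blast
      then show False
      proof cases
        case 1
        then show False using components_no_edge[OF P otherP(1)[OF B] H(1) otherP(2)[OF B]] ab by blast
      next
        case 2
        then obtain B' where "B' \<in> R" "b \<in> B'" using components_Union[OF R] by blast
        then show False using components_no_edge[OF R B(1)] ab by blast
      qed
    qed
  qed
  have link: "\<exists>a\<in>B. E x a" if B: "B \<in> R" "B \<noteq> K" for B
  proof -
    obtain b where "b \<in> B" using components_subset[OF R B(1)] by blast
    moreover have "v \<notin> B" using components_disjoint[OF R B(1) K(1) _ K(2)] B by blast
    ultimately obtain a c where "a \<in> S \<inter> B" "c \<in> S - B" "E a c"
      using conn_cut[OF con, of b B v] components_subset[OF R B(1)] v by blast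
    then show ?thesis using out[OF B] sym by blast
  qed
  have goodB: "good k B" if B: "B \<in> R" "B \<noteq> K" for B
  proof (rule IH)
    show "B \<subset> S" using components_subset[OF R B(1)] XS unfolding X_def by blast
    show "conn B" using components_conn[OF R B(1)] .
    obtain a where "a \<in> B" "E x a" using link[OF B] by blast
    then show "\<not> exceptional k B"
      using uniq[OF x H(1) otherP(1)[OF B] H(2)] y otherP(2)[OF B] by blast
  qed
  have UR: "\<Union>R = S - X" using components_Union[OF R] .
  show ?thesis
  proof (cases "exceptional k K")
    case False
    have "K \<subset> S" using KS x(1) by blast
    then have "good k K" using IH components_conn[OF R K(1)] False by blast
    then have "good k (S - X)" using good_Union[OF k _ R] goodB fin by blast
    \<comment> \<open>The order \<open>card H + 1\<close> of \<open>X\<close> is enough to pay for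
      the cover of \<open>H\<close>, which dominates \<open>x\<close> through
      \<open>y\<close>.\<close>
    obtain D where D: "D \<subseteq> H" "y \<in> D" "H \<subseteq> nb D" "(k + 1) * card D \<le> card H + 1"
      using exceptional_cover[OF H(2) y(1)] by blast
    have "x \<in> nb D" using D(2) y(2) sym by (auto simp: nb_def)
    then have e: "X - nb D = {}" using D(3) unfolding X_def by blast
    show ?thesis
    proof (rule good_split[OF fin XS _ _ _ _ \<open>good k (S - X)\<close>])
      show "D \<subseteq> X" using D(1) unfolding X_def by blast
      show "(k + 1) * card D \<le> card X" using D(4) cardX by simp
      show "clique_free k (X - nb D)" unfolding e by (rule clique_free_card) (use k in auto)
    qed (use e in auto)
  next
    case True
    define W where "W = X \<union> K"
    have WS: "W \<subseteq> S" unfolding W_def using XS KS by simp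
    have cardW: "card W = card H + card K + 1"
      unfolding W_def using finK finH KS cardX by (subst card_Un_disjoint) (auto simp: X_def)
    have SW: "S - W = \<Union>(R - {K})"
    proof
      show "S - W \<subseteq> \<Union>(R - {K})" using UR unfolding W_def by blast
      show "\<Union>(R - {K}) \<subseteq> S - W"
      proof
        fix z assume "z \<in> \<Union>(R - {K})"
        then obtain B where "B \<in> R" "B \<noteq> K" "z \<in> B" by blast
        then show "z \<in> S - W" using components_disjoint[OF R _ K(1)] components_subset[OF R] unfolding W_def by blast
      qed
    qed
    have goodSW: "good k (S - W)"
      unfolding SW
      by (rule good_Union[OF k _ components_sub[OF R]]) (use goodB fin SW in \<open>auto simp flip: SW\<close>)
    have noedge: "\<not> E a b" if "a \<in> W" "a \<noteq> x" "b \<in> S - W" for a b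
    proof
      assume "E a b"
      obtain B where B: "B \<in> R" "B \<noteq> K" "b \<in> B" using \<open>b \<in> S - W\<close> unfolding SW by blast
      then have "B \<subseteq> S - W" unfolding SW by blast
      then have "a \<in> S - B" using that WS by blast
      then show False using out[OF B(1,2) B(3) _ sym[OF \<open>E a b\<close>]] that by blast
    qed
    \<comment> \<open>Since only \<open>x\<close> has neighbours in \<open>S - W\<close>, dominating
      \<open>x\<close> cuts \<open>W\<close> off, and it remains to isolate within
      \<open>W\<close>.\<close>
    have fromW: "good k S" if D: "D \<subseteq> W" "x \<in> nb D" "(k + 1) * card D \<le> card W" "clique_free k (W - nb D)" for D
      by (rule good_split[OF fin WS D(1,3,4) _ goodSW]) (use D(2) noedge in blast)
    show ?thesis
      using True K(2)
    proof (cases rule: exceptional_cases)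
      case Kc: 1
      then have cK: "card K = k" and eK: "\<And>s t. s \<in> K \<Longrightarrow> t \<in> K \<Longrightarrow> s \<noteq> t \<Longrightarrow> E s t"
        unfolding clique_def by auto
      show ?thesis
        using H(2) y(1)
      proof (cases rule: exceptional_cases)
        case 1
        then have cH: "card H = k" and eH: "\<And>s t. s \<in> H \<Longrightarrow> t \<in> H \<Longrightarrow> s \<noteq> t \<Longrightarrow> E s t"
          unfolding clique_def by auto
        show ?thesis
        \<comment> \<open>Here \<open>W\<close> has \<open>2 * k + 1\<close> vertices, so the single
          vertex \<open>x\<close> is affordable.\<close>
        proof (cases "clique_free k (W - nb {x})")
          case True
          show ?thesis
            by (rule fromW[of "{x}"]) (use True cH cK cardW in \<open>auto simp: W_def X_def nb_def\<close>)
        next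
          case False
          then obtain C where C: "C \<subseteq> W - nb {x}" "clique k C" unfolding clique_free_def by blast
          have finC: "finite C" and cC: "card C = k" and eC: "\<And>s t. s \<in> C \<Longrightarrow> t \<in> C \<Longrightarrow> s \<noteq> t \<Longrightarrow> E s t"
            using C(2) unfolding clique_def by auto
          have yC: "y \<notin> C" and vC: "v \<notin> C" and xC: "x \<notin> C" and CHK: "C \<subseteq> H \<union> K"
            using C(1) y(2) sym[OF x(2)] unfolding W_def X_def nb_def by auto
          \<comment> \<open>\<open>C\<close> has \<open>k\<close> vertices and misses both
            \<open>v\<close> in \<open>K\<close> and \<open>y\<close> in \<open>H\<close>, so
            neither of these \<open>k\<close>-sets contains it; an edge \<open>z w\<close> between
            \<open>H\<close> and \<open>K\<close> results.\<close>
          have "\<not> C \<subseteq> K" using psubset_card_mono[OF finK, of C] vC K(2) cC cK by auto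
          then obtain z where z: "z \<in> C" "z \<in> H" using CHK by blast
          have "\<not> C \<subseteq> H" using psubset_card_mono[OF finH, of C] yC y(1) cC cH by auto
          then obtain w where w: "w \<in> C" "w \<in> K" using CHK by blast
          \<comment> \<open>\<open>S - N[z]\<close> is connected and at least \<open>k + 1\<close> vertices smaller. If it is a
            \<open>k\<close>-clique, then \<open>S = W\<close> and \<open>w\<close> dominates everything but \<open>x\<close> and \<open>y\<close>, so that \<open>{w}\<close>
            isolates unless \<open>S\<close> is the 5-cycle \<open>x y z w v\<close>.\<close>
          have zw: "z \<noteq> w" using z w KS(3) by blast
          then have Ezw: "E z w" "E w z" using eC z w by auto
          have Hz: "H \<subseteq> nb {z}" using eH[OF z(2)] by (auto simp: nb_def)
          have nzx: "\<not> E z x" "z \<noteq> x" "\<not> E x z" "\<not> E x w"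
            using C(1) z(1) w(1) sym by (auto simp: nb_def)
          have nzv: "\<not> E z v" "z \<noteq> v" using HS(2) z(2) sym by (auto simp: nb_def)
          have wv: "w \<noteq> v" using vC w by blast
          define T where "T = S - nb {z}"
          have ST: "S - (S \<inter> nb {z}) = T" unfolding T_def by blast
          have lift: "good k S" if "good k T"
          proof (rule good_split[OF fin, of "S \<inter> nb {z}" "{z}"])
            have "card (insert w H) \<le> card (S \<inter> nb {z})"
              using Hz HS(1) Ezw w(2) KS(1) fin by (intro card_mono) (auto simp: nb_def)
            moreover have "w \<notin> H" using w(2) KS(3) by blast
            ultimately show "(k + 1) * card {z} \<le> card (S \<inter> nb {z})" using finH cH by simp
            have e: "S \<inter> nb {z} - nb {z} = {}" by blast
            show "clique_free k (S \<inter> nb {z} - nb {z})" unfolding e by (rule clique_free_card) (use k in auto)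
            show "good k (S - (S \<inter> nb {z}))" unfolding ST using that .
          qed (use z HS in \<open>auto simp: nb_def\<close>)
          have vT: "v \<in> T" and xT: "x \<in> T" and wT: "w \<notin> T" and zT: "z \<notin> T"
            using nzv nzx Ezw v x unfolding T_def by (auto simp: nb_def)
          \<comment> \<open>\<open>z\<close> dominates all of \<open>H\<close>, but neither
            \<open>x\<close> nor any vertex outside \<open>W\<close>.\<close>
          have Teq: "T = ({x} \<union> (K - nb {z})) \<union> \<Union>(R - {K})"
          proof -
            have "z \<in> W" using z(2) unfolding W_def X_def by simp
            then have "(S - W) \<inter> nb {z} = {}" using noedge[of z] nzx(2) by (auto simp: nb_def)
            then show ?thesis
              using WS Hz xT unfolding SW[symmetric] T_def W_def X_def by blast
          qed
          have "conn ({x} \<union> (K - nb {z}))"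
          proof (rule conn_Un[OF conn_singleton])
            show vK: "v \<in> K - nb {z}" using K(2) vT unfolding T_def by blast
            show "conn (K - nb {z})" by (rule conn_clique) (use eK vK in auto)
            show "x \<in> {x}" "E x v" using sym[OF x(2)] by auto
          qed
          then have connT: "conn T"
            unfolding Teq
          proof (rule conn_attach)
            show "finite (R - {K})" using finite_comps[OF R] fin by simp
            show "conn B \<and> (\<exists>a\<in>{x} \<union> (K - nb {z}). \<exists>b\<in>B. E a b)" if "B \<in> R - {K}" for B
              using link[of B] components_conn[OF R, of B] that by blast
          qed
          show ?thesis
          proof (cases "exceptional k T")
            case False
            have "T \<subset> S" using zT z HS unfolding T_def by blast
            then show ?thesis using IH connT False lift by blast
          next
            case True
            then show ?thesis
              using vT
            proof (cases rule: exceptional_cases)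
              case 1
              \<comment> \<open>\<open>v\<close> has no neighbour outside \<open>W\<close>, whereas
                a vertex of \<open>S - W\<close> would belong to the clique \<open>T\<close> along
                with \<open>v\<close>.\<close>
              have SW0: "S - W = {}"
              proof (rule ccontr)
                assume "S - W \<noteq> {}"
                then obtain b where b: "b \<in> S - W" by blast
                then have "b \<in> T" using Teq SW by simp
                moreover have "v \<in> W" "b \<noteq> v" using K(2) b unfolding W_def by auto
                moreover from this have "\<not> E v b" using noedge[of v b] xv b by simp
                ultimately show False using 1 vT unfolding clique_def by simp
              qed
              have SeqW: "S = W" using SW0 WS by blast
              have Teq': "T = insert x (K - nb {z})" using Teq SW0 unfolding SW by simp
              \<comment> \<open>Counting \<open>T\<close> shows that \<open>w\<close> is the only
                neighbour of \<open>z\<close> in \<open>K\<close>; hence \<open>C\<close> consists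
                of \<open>w\<close> and of \<open>H\<close> without \<open>y\<close>, and
                \<open>w\<close> dominates all of \<open>W\<close> except possibly \<open>x\<close>
                and \<open>y\<close>.\<close>
              have "card T = k" using 1 unfolding clique_def by simp
              then have "card (K - nb {z}) + 1 = k" using Teq' KS(2) finK by simp
              moreover have "card (K - nb {z}) + card (K \<inter> nb {z}) = card K"
                using card_Int_Diff[OF finK, of "nb {z}"] by simp
              ultimately have "card (K \<inter> nb {z}) = 1" using cK by simp
              moreover have "w \<in> K \<inter> nb {z}" using w Ezw by (auto simp: nb_def)
              ultimately have Kz: "K \<inter> nb {z} = {w}" by (metis card_1_singletonE singletonD)
              have "C \<subseteq> nb {z}" using eC[OF z(1)] by (auto simp: nb_def)
              then have "C - {w} \<subseteq> H - {y}" using CHK Kz yC by blast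
              moreover have "card (C - {w}) = card (H - {y})"
                using w(1) y(1) finC finH cC cH by simp
              ultimately have CH: "C - {w} = H - {y}" using finH by (intro card_subset_eq) auto
              have Wnb: "W - nb {w} \<subseteq> {x, y}"
                using eK[OF w(2)] eC[OF w(1)] CH unfolding W_def X_def by (auto simp: nb_def)
              have wS: "w \<in> S" using w(2) KS(1) by blast
              have "card {z, w} \<le> card C" using z w finC by (intro card_mono) auto
              then have k2: "k \<ge> 2" using zw cC by simp
              show ?thesis
              proof (cases "clique_free k (W - nb {w})")
                case True
                then show ?thesis
                  using good_via_free[OF fin, of "{w}" k] wS cardW cK cH SeqW by auto
              next
                case False
                \<comment> \<open>A surviving clique has at most the two vertices \<open>x\<close>
                  and \<open>y\<close>, so \<open>k = 2\<close> and both survive; the five vertices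
                  then form an induced 5-cycle, against \<open>nexc\<close>.\<close>
                have "\<not> card (W - nb {w}) < k" using False clique_free_card[of "W - nb {w}" k] Wnb
                  by (auto dest: finite_subset)
                moreover have "card (W - nb {w}) \<le> card {x, y}" using Wnb by (intro card_mono) auto
                moreover have "card {x, y} = 2" using xH y(1) by (auto simp: card_insert_if)
                ultimately have keq: "k = 2" and Weq: "card (W - nb {w}) = card {x, y}" using k2 by auto
                have "W - nb {w} = {x, y}" using Wnb Weq by (intro card_subset_eq) auto
                then have nwy: "\<not> E w y" "\<not> E y w" using sym by (auto simp: nb_def)
                have zy: "z \<noteq> y" using z yC by blast
                have Heq: "H = {y, z}"
                  using card_subset_eq[OF finH, of "{y, z}"] cH keq zy y z by auto
                have Keq: "K = {v, w}"
                  using card_subset_eq[OF finK, of "{v, w}"] cK keq wv K w by auto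
                have "S = {x, y, z, w, v}" unfolding SeqW W_def X_def Heq Keq by blast
                moreover have "cyc5 x y z w v"
                  unfolding cyc5_def
                  using nzx nzv nwy zy zw wv Ezw y xH Heq KS Keq xv x(2) vH eH[OF y(1) z(2)] eK[OF w(2) K(2)]
                    HS(2) sym by (auto simp: nb_def)
                ultimately have "exceptional k S" unfolding exceptional_def using keq by blast
                then show ?thesis using nexc by simp
              qed
            next
              case (2 b c d e)
              note f = cyc5_facts[OF 2(3)]
              have Keq: "K = {v, w}"
                using card_subset_eq[OF finK, of "{v, w}"] cK 2(1) wv K w by auto
              \<comment> \<open>The two neighbours of \<open>v\<close> on the 5-cycle
                \<open>T\<close> lie in \<open>K = {v, w}\<close> unless they equal
                \<open>x\<close>, and \<open>w\<close> is not in \<open>T\<close>; so both would be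
                \<open>x\<close>.\<close>
              have "b = x" "e = x"
                using nvK[of b] nvK[of e] f 2(2) wT Keq unfolding T_def by auto
              then show ?thesis using f by simp
            qed
          qed
        qed
      next
        case (2 b c d e)
        note f = cyc5_facts[OF 2(3)]
        have cW: "card W = 8" using cardW cK 2 f(1) by simp
        obtain w where Keq: "K = {v, w}" "v \<noteq> w"
          using cK 2(1) K(2) by (auto simp: card_2_iff doubleton_eq_iff)
        have Weq: "W = {x, y, b, c, d, e, v, w}" unfolding W_def X_def 2(2) Keq by blast
        have Evw: "E v w" "E w v" using eK Keq by auto
        have nv: "\<not> E v s \<and> \<not> E s v" if "s \<in> H" for s using HS(2) that sym by (auto simp: nb_def)
        show ?thesis
        \<comment> \<open>\<open>W\<close> has 8 vertices, so two may be chosen. The pair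
          \<open>y, b\<close> leaves at most \<open>v\<close> and \<open>d\<close> if
          \<open>w\<close> is adjacent to \<open>b\<close>; otherwise the pair \<open>x, d\<close>
          leaves at most the nonadjacent vertices \<open>w\<close> and \<open>b\<close>.\<close>
        proof (cases "E w b")
          case True
          have "W - nb {y, b} \<subseteq> {v, d}"
            unfolding Weq using f True sym y(2) by (auto simp: nb_def)
          moreover have "clique_free 2 {v, d}"
            using nv[of d] irrefl 2(2) by (intro clique_free_2) auto
          ultimately have "clique_free k (W - nb {y, b})" using clique_free_mono 2(1) by blast
          then show ?thesis
            by (intro fromW[of "{y, b}"]) (use y(2) sym cW f(2) 2(1) Weq in \<open>auto simp: nb_def\<close>)
        next
          case False
          have "W - nb {x, d} \<subseteq> {w, b}"
            unfolding Weq using f y(2) sym[OF x(2)] by (auto simp: nb_def)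
          moreover have "clique_free 2 {w, b}"
            using False sym irrefl by (intro clique_free_2) auto
          ultimately have "clique_free k (W - nb {x, d})" using clique_free_mono 2(1) by blast
          then show ?thesis
            by (intro fromW[of "{x, d}"]) (use cW 2(1) Weq card_insert_le_m1[of 2 "{d}" x] in \<open>auto simp: nb_def card_insert_if\<close>)
        qed
      qed
    next
      case (2 b c d e)
      note f = cyc5_facts[OF 2(3)]
      \<comment> \<open>\<open>{c, d}\<close> is an exceptional component linked to \<open>b\<close> and \<open>e\<close>, so by uniqueness
        \<open>H\<close> is linked to neither and hence not to \<open>K\<close> at all.\<close>
      have inS: "b \<in> S" "c \<in> S" "d \<in> S" "e \<in> S" using KS(1) 2(2) by auto
      have "{c, d} \<subseteq> S - nb {v}" using f inS by (auto simp: nb_def)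
      then obtain H2 where H2: "H2 \<in> P" "c \<in> H2" using components_Union[OF P] by blast
      have "conn {c, d}" by (rule conn_clique) (use f in auto)
      then have cd: "{c, d} \<subseteq> H2"
        using conn_subset_component[OF P _ \<open>{c, d} \<subseteq> S - nb {v}\<close> H2(1)] H2(2) by blast
      have H2H: "H2 \<noteq> H" using KS(3) 2(2) H2(2) by blast
      then have "H2 \<subseteq> S - X"
        using components_disjoint[OF P H2(1) H(1)] components_subset[OF P H2(1)] x unfolding X_def by (auto simp: nb_def)
      then have "H2 \<subseteq> K"
        using conn_subset_component[OF R components_conn[OF P H2(1)] _ K(1)] H2(2) 2(2) by blast
      then have "H2 \<subseteq> {c, d}"
        using components_subset[OF P H2(1)] f unfolding 2(2) by (auto simp: nb_def)
      then have "H2 = {c, d}" using cd by blast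
      then have excH2: "exceptional k H2" unfolding exceptional_def clique_def using f 2(1) by auto
      have noHK: "\<not> E h t" if "h \<in> H" "t \<in> K" for h t
      proof
        assume "E h t"
        have "t \<noteq> v" using HS(2) that(1) \<open>E h t\<close> sym by (auto simp: nb_def)
        then have "t = b \<or> t = e \<or> t \<in> H2" using \<open>t \<in> K\<close> cd unfolding 2(2) by auto
        then consider "t = b" | "t = e" | "t \<in> H2" by blast
        then show False
        proof cases
          case 1
          then have "E b h" using sym[OF \<open>E h t\<close>] by simp
          then show False using uniq[OF inS(1) f(3) H(1) H2(1) H(2) excH2 that(1) _ H2(2) f(5)] H2H by simp
        next
          case 2
          have "d \<in> H2" using cd by blast
          moreover have "E e h" using sym[OF \<open>E h t\<close>] 2 by simp
          ultimately show False using uniq[OF inS(4) f(12) H(1) H2(1) H(2) excH2 that(1) _ _ f(10)] H2H by simp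
        next
          case 3
          then show False using components_no_edge[OF P H(1) H2(1) H2H[symmetric] that(1)] \<open>E h t\<close> by simp
        qed
      qed
      obtain g where g: "g \<subseteq> H" "card H = k + (k + 1) * card g" "clique_free k (H - {y} - nb g)"
        using exceptional_hit[OF H(2) y(1) k] by blast
      \<comment> \<open>\<open>x\<close> dominates \<open>v\<close> and \<open>y\<close>, and
        \<open>c\<close> dominates \<open>b\<close> and \<open>d\<close>, so of \<open>K\<close> at
        most \<open>e\<close> is left, which has no edge to \<open>H\<close>. The cost is at most
        \<open>3 * (2 + card g)\<close>, below \<open>card W = 8 + 3 * card g\<close>.\<close>
      let ?D = "{x, c} \<union> g"
      have sub: "W - nb ?D \<subseteq> (H - {y} - nb g) \<union> {e}"
        unfolding W_def X_def 2(2) using f y(2) sym[OF x(2)] by (auto simp: nb_def)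
      have "clique_free k ((H - {y} - nb g) \<union> {e})"
      proof (rule clique_free_Un[OF g(3)])
        show "clique_free k {e}" by (rule clique_free_card) (use 2(1) in auto)
      qed (use noHK 2(2) in auto)
      then have free: "clique_free k (W - nb ?D)" using sub clique_free_mono by blast
      have "card ?D \<le> card {x, c} + card g" by (rule card_Un_le)
      moreover have "card {x, c} \<le> 2" by (auto simp: card_insert_if)
      ultimately have "card ?D \<le> 2 + card g" by linarith
      moreover have "card W = 8 + 3 * card g" using cardW g(2) 2 f(1) by simp
      ultimately have "(k + 1) * card ?D \<le> card W" using 2(1) by simp
      moreover have "?D \<subseteq> W" using g(1) 2(2) unfolding W_def X_def by auto
      ultimately show ?thesis using fromW[of ?D] free by (simp add: nb_def)
    qed
  qed
qed

text \<open>An edge leaving \<open>H\<close> cannot end in another component, nor in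
  \<open>v\<close>, because \<open>H\<close> avoids \<open>N[v]\<close>; its outer end is therefore
  a neighbour of \<open>v\<close>.\<close>

lemma components_link:
  assumes con: "conn S" and v: "v \<in> S" and P: "components (S - nb {v}) P" and H: "H \<in> P"
  shows "\<exists>x\<in>S. E v x \<and> (\<exists>y\<in>H. E x y)"
proof -
  have HS: "H \<subseteq> S - nb {v}" "H \<noteq> {}" using components_subset[OF P H] by auto
  then obtain h where h: "h \<in> H" by blast
  have "v \<notin> H" using HS by (auto simp: nb_def)
  then obtain a b where ab: "a \<in> S \<inter> H" "b \<in> S - H" "E a b"
    using conn_cut[OF con, of h H v] h v HS by blast
  have "b \<in> nb {v}"
  proof (rule ccontr)
    assume "b \<notin> nb {v}"
    then obtain B where "B \<in> P" "b \<in> B" using components_Union[OF P] ab(2) by blast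
    moreover from this have "B \<noteq> H" using ab(2) by blast
    ultimately show False using components_no_edge[OF P H, of B a b] ab by blast
  qed
  moreover have "b \<noteq> v" using ab HS sym by (auto simp: nb_def)
  ultimately have "E v b" by (simp add: nb_def)
  then show ?thesis using ab sym by blast
qed

theorem good_if_conn:
  assumes "finite S" "conn S" "\<not> exceptional k S" "k \<ge> 1"
  shows "good k S"
  using assms(1-3)
proof (induction S rule: finite_psubset_induct)
  case (psubset S)
  note fin = \<open>finite S\<close> and con = \<open>conn S\<close> and nexc = \<open>\<not> exceptional k S\<close> and k = \<open>k \<ge> 1\<close>
  show ?case
  proof (cases "clique_free k S")
    case True
    then show ?thesis unfolding good_def by (intro exI[of _ "{}"]) simp
  next
    case False
    then obtain C where C: "C \<subseteq> S" "clique k C" unfolding clique_free_def by blast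
    then have "C \<noteq> S" using nexc unfolding exceptional_def by blast
    then obtain u' where u': "u' \<in> S" "u' \<notin> C" using C(1) by blast
    obtain c where "c \<in> C" using C(2) k unfolding clique_def by fastforce
    \<comment> \<open>\<open>C\<close> is a proper subset of the connected set \<open>S\<close>, so
      some vertex \<open>v\<close> of \<open>C\<close> has a neighbour outside \<open>C\<close>;
      this gives \<open>k + 1\<close> vertices in \<open>N[v]\<close>, enough to pay for
      \<open>v\<close>.\<close>
    then obtain v u where vu: "v \<in> S \<inter> C" "u \<in> S - C" "E v u"
      using conn_cut[OF con, of c C u'] C(1) u' by blast
    then have v: "v \<in> S" by blast
    have "insert u C \<subseteq> S \<inter> nb {v}" using C vu by (auto simp: clique_def nb_def)
    then have "card (insert u C) \<le> card (S \<inter> nb {v})" using fin by (intro card_mono) auto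
    then have cnb: "k + 1 \<le> card (S \<inter> nb {v})" using C(2) vu(2) by (simp add: clique_def)
    obtain P where P: "components (S - nb {v}) P" using components_exist fin by blast
    have gP: "good k B" if "B \<in> P" "\<not> exceptional k B" for B
    proof (rule psubset.IH)
      have "v \<in> nb {v}" by (simp add: nb_def)
      then show "B \<subset> S" using components_subset[OF P that(1)] v by blast
    qed (use components_conn[OF P that(1)] that(2) in auto)
    show ?thesis
    proof (cases "\<exists>H\<in>P. exceptional k H")
      case False
      then have "good k (S - nb {v})" using good_Union[OF k _ P] gP fin by blast
      moreover have "S - S \<inter> nb {v} = S - nb {v}" by blast
      ultimately have g: "good k (S - S \<inter> nb {v})" by simp
      show ?thesis
      proof (rule good_split[OF fin _ _ _ _ _ g])
        have e: "S \<inter> nb {v} - nb {v} = {}" by blast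
        show "clique_free k (S \<inter> nb {v} - nb {v})" unfolding e by (rule clique_free_card) (use k in auto)
        show "(k + 1) * card {v} \<le> card (S \<inter> nb {v})" using cnb by simp
      qed (use v in \<open>auto simp: nb_def\<close>)
    next
      case True
      then obtain H where H: "H \<in> P" "exceptional k H" by blast
      obtain x y where xy: "x \<in> S" "E v x" "y \<in> H" "E x y"
        using components_link[OF con v P H(1)] by blast
      show ?thesis
      proof (cases "\<exists>x H1 H2. x \<in> S \<and> E v x \<and> H1 \<in> P \<and> H2 \<in> P \<and> H1 \<noteq> H2 \<and> exceptional k H1 \<and> exceptional k H2 \<and>
          (\<exists>y\<in>H1. E x y) \<and> (\<exists>y\<in>H2. E x y)")
        case True
        then obtain x H1 H2 where "x \<in> S" "E v x" "H1 \<in> P" "H2 \<in> P" "H1 \<noteq> H2" "exceptional k H1" "exceptional k H2"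
          "\<exists>y\<in>H1. E x y" "\<exists>y\<in>H2. E x y" by blast
        then show ?thesis
          using good_two_exceptional[OF k fin v P, of x H1 H2] components_link[OF con v P] gP by blast
      next
        case False
        show ?thesis
        proof (rule good_unique_exceptional[OF k fin con nexc _ v P H xy])
          show "good k T" if "T \<subset> S" "conn T" "\<not> exceptional k T" for T using psubset.IH that by blast
          show "H1 = H2" if "x' \<in> S" "E v x'" "H1 \<in> P" "H2 \<in> P" "exceptional k H1" "exceptional k H2"
            "y1 \<in> H1" "E x' y1" "y2 \<in> H2" "E x' y2" for x' H1 H2 y1 y2
            using False that by blast
        qed
      qed
    qed
  qed
qed

end

section \<open>Transfer to the digraph library\<close>

abbreviation adj :: "'a pair_pre_digraph \<Rightarrow> 'a \<Rightarrow> 'a \<Rightarrow> bool" where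
  "adj G x y \<equiv> (x, y) \<in> parcs G"

lemma pair_graph_adjacency:
  assumes "pair_graph G" shows "adjacency (adj G)"
proof -
  interpret pair_graph G by fact
  show ?thesis
  proof
    show "adj G y x" if "adj G x y" for x y
      using arcs_ends_symmetric[OF pair_sym_arcs] that by simp
    show "\<not> adj G x x" for x using pair_no_loops[of "(x, x)"] by auto
  qed
qed

text \<open>Connectedness in the library is strong connectedness of the symmetric closure
  \<open>M\<close>, which has the arcs of \<open>G\<close>. A path out of \<open>A\<close> must
  cross the cut; conversely, an unreachable vertex makes the set of vertices reachable from
  \<open>u\<close> a cut without crossing edges.\<close>

lemma connected_iff_conn:
  assumes "pair_graph G"
  shows "Digraph_Component.connected (with_proj G) \<longleftrightarrow> adjacency.conn (adj G) (pverts G)"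
proof -
  interpret G: pair_graph G by fact
  interpret adjacency "adj G" by (rule pair_graph_adjacency) fact
  define M where "M = mk_symmetric (with_proj G)"
  have M: "pverts M = pverts G" "parcs M = parcs G"
    unfolding M_def mk_symmetric_def using sym by auto
  have wfM: "wf_digraph (with_proj M)"
    by unfold_locales (auto simp: M G.arc_fst_in_verts G.arc_snd_in_verts)
  show ?thesis
  proof
    assume "Digraph_Component.connected (with_proj G)"
    then have sc: "pverts G \<noteq> {}" "\<And>u v. u \<in> pverts G \<Longrightarrow> v \<in> pverts G \<Longrightarrow> u \<rightarrow>\<^sup>*\<^bsub>with_proj M\<^esub> v"
      unfolding connected_def strongly_connected_def M_def[symmetric] by (auto simp: M)
    show "conn (pverts G)"
      unfolding conn_def
    proof (intro conjI allI impI)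
      fix A assume A: "A \<subseteq> pverts G" "A \<noteq> {}" "A \<noteq> pverts G"
      then obtain u v where uv: "u \<in> A" "v \<in> pverts G" "v \<notin> A" by blast
      then have "u \<rightarrow>\<^sup>*\<^bsub>with_proj M\<^esub> v" using sc A by blast
      then have "v \<in> A \<or> (\<exists>a\<in>A. \<exists>b\<in>pverts G - A. adj G a b)"
        using uv(1)
      proof (induction rule: wf_digraph.reachable_induct[OF wfM, consumes 1])
        case (2 x y)
        then show ?case using G.arc_snd_in_verts by (fastforce simp: M)
      qed auto
      then show "\<exists>a\<in>A. \<exists>b\<in>pverts G - A. adj G a b" using uv by blast
    qed fact
  next
    assume con: "conn (pverts G)"
    have "u \<rightarrow>\<^sup>*\<^bsub>with_proj M\<^esub> v" if uv: "u \<in> pverts G" "v \<in> pverts G" for u v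
    proof (rule ccontr)
      assume n: "\<not> u \<rightarrow>\<^sup>*\<^bsub>with_proj M\<^esub> v"
      have "u \<rightarrow>\<^sup>*\<^bsub>with_proj M\<^esub> u" using uv wf_digraph.reachable_refl[OF wfM] by (simp add: M)
      then obtain a b where ab: "u \<rightarrow>\<^sup>*\<^bsub>with_proj M\<^esub> a" "\<not> u \<rightarrow>\<^sup>*\<^bsub>with_proj M\<^esub> b" "adj G a b"
        using conn_cut[OF con uv(1) _ uv(2), of "{a. u \<rightarrow>\<^sup>*\<^bsub>with_proj M\<^esub> a}"] n by blast
      then show False using wf_digraph.reachable_adj_trans[OF wfM, of u a b] by (simp add: M)
    qed
    moreover have "pverts G \<noteq> {}" using con unfolding conn_def by blast
    ultimately show "Digraph_Component.connected (with_proj G)"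
      unfolding connected_def strongly_connected_def M_def[symmetric] by (simp add: M)
  qed
qed

text \<open>Compatibility with \<open>G\<close> forces \<open>tail\<close> and \<open>head\<close>
  of a library subgraph to be \<open>fst\<close> and \<open>snd\<close>, so that its arcs are vertex
  pairs of \<open>G\<close>; conversely, a clique \<open>C\<close> carries the complete pair
  digraph.\<close>

lemma has_clique_iff:
  assumes "pair_graph G" "U \<subseteq> pverts G"
  shows "has_clique k (with_proj G \<restriction> U) \<longleftrightarrow> \<not> adjacency.clique_free (adj G) k U"
proof -
  interpret G: pair_graph G by fact
  interpret adjacency "adj G" by (rule pair_graph_adjacency) fact
  let ?GU = "with_proj G \<restriction> U"
  show ?thesis
  proof
    assume "has_clique k ?GU"
    then obtain H where H: "subgraph H ?GU" "complete_digraph k H"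
      unfolding has_clique_def by blast
    have "fin_digraph H" using H(2) unfolding complete_digraph_def graph_def digraph_def by blast
    then have fin: "finite (verts H)" by (rule fin_digraph.finite_verts)
    have th: "tail H = fst" "head H = snd" "arcs H \<subseteq> parcs G" "verts H \<subseteq> U"
      using H(1) unfolding subgraph_def compatible_def by (auto simp: induce_subgraph_def)
    have "adj G x y" if "x \<in> verts H" "y \<in> verts H" "x \<noteq> y" for x y
    proof -
      have "(x, y) \<in> arcs_ends H" using that H(2) unfolding complete_digraph_def by auto
      then show ?thesis using th unfolding arcs_ends_conv by auto
    qed
    then have "clique k (verts H)" using fin H(2) unfolding clique_def complete_digraph_def by blast
    then show "\<not> clique_free k U" using th(4) unfolding clique_free_def by blast
  next
    assume "\<not> clique_free k U"
    then obtain C where C: "C \<subseteq> U" "clique k C" unfolding clique_free_def by blast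
    let ?H = "\<lparr>pverts = C, parcs = {(u, v). (u, v) \<in> C \<times> C \<and> u \<noteq> v}\<rparr>"
    have "complete_digraph k (with_proj ?H)"
      using C(2) unfolding complete_digraph_pair_def clique_def by simp
    moreover have "subgraph (with_proj ?H) ?GU"
      unfolding subgraph_def
    proof (intro conjI)
      show "wf_digraph ?GU" by unfold_locales (auto simp: induce_subgraph_def)
      show "wf_digraph (with_proj ?H)" by unfold_locales auto
      show "compatible ?GU (with_proj ?H)" by (simp add: compatible_def induce_subgraph_def)
    qed (use C in \<open>auto simp: clique_def induce_subgraph_def\<close>)
    ultimately show "has_clique k ?GU" unfolding has_clique_def by blast
  qed
qed

section \<open>Isolating sets and the isolation number\<close>

lemma clique_isolating_iff:
  assumes "pair_graph G"
  shows "clique_isolating k (with_proj G) D \<longleftrightarrow>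
    D \<subseteq> pverts G \<and> adjacency.clique_free (adj G) k (pverts G - adjacency.nb (adj G) D)"
proof -
  interpret adjacency "adj G" by (rule pair_graph_adjacency) fact
  have "closed_nbhd (with_proj G) D = nb D" unfolding closed_nbhd_def nb_def by auto
  then show ?thesis
    unfolding clique_isolating_def using has_clique_iff[OF assms, of "pverts G - nb D" k] by auto
qed

lemma finite_isolating_cards:
  assumes "pair_graph G"
  shows "finite {card D |D. clique_isolating k (with_proj G) D}"
proof -
  interpret G: pair_graph G by fact
  have "{card D |D. clique_isolating k (with_proj G) D} \<subseteq> card ` Pow (pverts G)"
    unfolding clique_isolating_def by auto
  then show ?thesis using G.pair_finite_verts finite_subset by blast
qed

lemma iota_attained:
  assumes "pair_graph G" "k \<ge> 1"
  shows "\<exists>D. clique_isolating k (with_proj G) D \<and> card D = iota (with_proj G) k"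
proof -
  interpret adjacency "adj G" by (rule pair_graph_adjacency) fact
  have "clique_free k (pverts G - nb (pverts G))"
    using subset_nb[of "pverts G"] clique_free_card[of "{}" k] assms(2) by (simp add: Diff_eq_empty_iff[THEN iffD2])
  then have "clique_isolating k (with_proj G) (pverts G)"
    using clique_isolating_iff[OF assms(1)] by blast
  then have "iota (with_proj G) k \<in> {card D |D. clique_isolating k (with_proj G) D}"
    unfolding iota_def by (intro Min_in finite_isolating_cards assms) blast
  then show ?thesis by auto
qed

section \<open>The 5-cycle as a digraph\<close>

lemma pverts_C5: "pverts C5 = {1, 2, 3, 4, 5}"
  unfolding C5_def by auto

lemma parcs_C5:
  "parcs C5 = {(1,2),(2,1),(2,3),(3,2),(3,4),(4,3),(4,5),(5,4),(5,1),(1,5)}"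
proof (rule set_eqI, clarify)
  fix i j :: nat
  show "(i, j) \<in> parcs C5 \<longleftrightarrow>
      (i, j) \<in> {(1,2),(2,1),(2,3),(3,2),(3,4),(4,3),(4,5),(5,4),(5,1),(1,5)}"
    unfolding C5_def path_graph_def by simp presburger
qed

lemma cyc5_digraph_iso:
  assumes G: "pair_graph G" and V: "pverts G = {a, b, c, d, e}"
    and cyc: "adjacency.cyc5 (adj G) a b c d e"
  shows "digraph_iso (with_proj G) (with_proj C5)"
proof -
  interpret G: pair_graph G by fact
  interpret adjacency "adj G" by (rule pair_graph_adjacency) fact
  note f = cyc5_facts[OF cyc]
  have dist: "distinct [a, b, c, d, e]" using f(2) .
  have arcs: "parcs G = {(a,b),(b,a),(b,c),(c,b),(c,d),(d,c),(d,e),(e,d),(e,a),(a,e)}" (is "_ = ?A")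
  proof
    show "?A \<subseteq> parcs G" using f by auto
    show "parcs G \<subseteq> ?A"
    proof
      fix p assume p: "p \<in> parcs G"
      obtain s t where st: "p = (s, t)" by (cases p)
      then have "s \<in> {a, b, c, d, e}" "t \<in> {a, b, c, d, e}" "s \<noteq> t"
        using p G.arc_fst_in_verts G.arc_snd_in_verts G.pair_no_loops V by fastforce+
      then show "p \<in> ?A" using p f(13-) unfolding st by auto
    qed
  qed
  \<comment> \<open>The labels follow the cycle; the isomorphism acts on arcs by \<open>g\<close> in
    both coordinates.\<close>
  define g :: "'a \<Rightarrow> nat" where
    "g = (\<lambda>x. if x = a then 1 else if x = b then 2 else if x = c then 3 else if x = d then 4 else 5)"
  have g: "g a = 1" "g b = 2" "g c = 3" "g d = 4" "g e = 5" unfolding g_def using dist by auto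
  have inj: "inj_on g (pverts G)" unfolding V by (auto simp: inj_on_def g)
  define h where "h = \<lparr>iso_verts = g, iso_arcs = map_prod g g, iso_head = snd, iso_tail = fst\<rparr>"
  have "pre_digraph.digraph_isomorphism (with_proj G) h"
    unfolding pre_digraph.digraph_isomorphism_def
  proof (intro conjI)
    show "wf_digraph (with_proj G)" by (rule G.wf_digraph)
    show "inj_on (iso_arcs h) (arcs (with_proj G))"
      unfolding h_def
      by (auto intro!: inj_on_subset[OF map_prod_inj_on[OF inj inj]] dest: G.in_arcsD1 G.in_arcsD2)
  qed (use inj in \<open>auto simp: h_def\<close>)
  moreover have "with_proj C5 = app_iso h (with_proj G)"
    unfolding app_iso_def with_proj_def by (simp add: h_def V g arcs pverts_C5 parcs_C5)
  ultimately show ?thesis unfolding digraph_iso_def by blast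
qed

text \<open>An isomorphism maps edges to edges, and \<open>C5\<close> has no triangle. This excludes
  \<open>B_graph n 2\<close> for \<open>n \<ge> 3\<close>, where vertex 1 and the two vertices of
  its clique form a triangle.\<close>

lemma not_C5_if_triangle:
  assumes "adj G x y" "adj G y z" "adj G x z"
  shows "\<not> digraph_iso (with_proj G) (with_proj C5)"
proof
  assume "digraph_iso (with_proj G) (with_proj C5)"
  then obtain h where h: "pre_digraph.digraph_isomorphism (with_proj G) h"
    and C5: "with_proj C5 = app_iso h (with_proj G)"
    unfolding digraph_iso_def by blast
  have "adj C5 (iso_verts h s) (iso_verts h t)" if "adj G s t" for s t
  proof -
    have "iso_tail h = fst" "iso_head h = snd" "iso_arcs h ` parcs G = parcs C5"
      using arg_cong[OF C5, of tail] arg_cong[OF C5, of head] arg_cong[OF C5, of arcs] by auto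
    moreover have "iso_verts h s = iso_tail h (iso_arcs h (s, t))" "iso_verts h t = iso_head h (iso_arcs h (s, t))"
      using h that unfolding pre_digraph.digraph_isomorphism_def by fastforce+
    ultimately have "(iso_verts h s, iso_verts h t) = iso_arcs h (s, t)" by simp
    then show ?thesis using that \<open>iso_arcs h ` parcs G = parcs C5\<close> by (metis image_eqI)
  qed
  then have *: "adj C5 (iso_verts h x) (iso_verts h y)" "adj C5 (iso_verts h y) (iso_verts h z)"
    "adj C5 (iso_verts h x) (iso_verts h z)" using assms by auto
  have "\<not> adj C5 p r" if "adj C5 p q" "adj C5 q r" for p q r
    using that unfolding parcs_C5 by (elim insertE emptyE) simp_all
  then show False using * by blast
qed

text \<open>The two excluded isomorphism types are translated into \<open>exceptional\<close>. The
  multiplied form serves both the real bound and, by integer division, the bound by the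
  floor.\<close>

theorem iota_le:
  assumes G: "pair_graph G" and k: "k \<ge> 1" and con: "Digraph_Component.connected (with_proj G)"
    and nK: "\<not> complete_digraph k (with_proj G)"
    and nC5: "\<not> (k = 2 \<and> digraph_iso (with_proj G) (with_proj C5))"
  shows "(k + 1) * iota (with_proj G) k \<le> card (pverts G)"
proof -
  interpret G: pair_graph G by fact
  interpret adjacency "adj G" by (rule pair_graph_adjacency) fact
  have "\<not> clique k (pverts G)"
  proof
    assume "clique k (pverts G)"
    moreover have "parcs G \<subseteq> {(u, v). (u, v) \<in> pverts G \<times> pverts G \<and> u \<noteq> v}"
      using G.arc_fst_in_verts G.arc_snd_in_verts irrefl by fastforce
    ultimately have "complete_digraph k (with_proj G)"
      unfolding complete_digraph_pair_def clique_def by auto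
    then show False using nK by simp
  qed
  then have "\<not> exceptional k (pverts G)"
    unfolding exceptional_def using nC5 cyc5_digraph_iso[OF G] by blast
  then have "good k (pverts G)"
    using good_if_conn[OF G.pair_finite_verts] con connected_iff_conn[OF G] k by blast
  then obtain D where D: "clique_isolating k (with_proj G) D" "(k + 1) * card D \<le> card (pverts G)"
    unfolding good_def clique_isolating_iff[OF G] by blast
  have "iota (with_proj G) k \<le> card D"
    unfolding iota_def by (rule Min_le[OF finite_isolating_cards[OF G]]) (use D(1) in blast)
  then have "(k + 1) * iota (with_proj G) k \<le> (k + 1) * card D" by (rule mult_left_mono) simp
  then show ?thesis using D(2) by linarith
qed

section \<open>The extremal graphs\<close>

text \<open>These facts show that the truncated subtraction in \<open>B_b\<close> is exact and that
  every vertex \<open>i\<close> with a clique attached lies on the path.\<close>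

lemma B_bounds:
  "B_a n k \<le> B_b n k" "B_b n k + B_a n k * k = n"
proof -
  have "B_a n k * (k + 1) \<le> n" unfolding B_a_def by (rule div_times_less_eq_dividend)
  then show "B_a n k \<le> B_b n k" "B_b n k + B_a n k * k = n"
    unfolding B_b_def by (auto simp: algebra_simps)
qed

text \<open>The offsets of block \<open>i\<close> past the path run from
  \<open>(i - 1) * k + 1\<close> to \<open>i * k\<close>; lowering them by 1 lets division recover
  the block number, whence disjointness.\<close>

lemma F_verts_index:
  assumes "w \<in> F_verts n k i" "i \<ge> 1"
  shows "i = (w - B_b n k - 1) div k + 1"
proof -
  obtain j where j: "i = Suc j" using assms(2) by (cases i) auto
  have "j * k \<le> w - B_b n k - 1" "w - B_b n k - 1 < (j + 1) * k"
    using assms(1) unfolding F_verts_def j by auto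
  then have "(w - B_b n k - 1) div k = j" by (intro div_nat_eqI) (auto simp: algebra_simps)
  then show ?thesis using j by simp
qed

lemma F_verts_disjoint:
  "w \<in> F_verts n k i \<Longrightarrow> w \<in> F_verts n k j \<Longrightarrow> i \<ge> 1 \<Longrightarrow> j \<ge> 1 \<Longrightarrow> i = j"
  using F_verts_index by metis

lemma F_verts_gt: "w \<in> F_verts n k i \<Longrightarrow> B_b n k < w"
  unfolding F_verts_def by auto

lemma card_F_verts: "i \<ge> 1 \<Longrightarrow> card (F_verts n k i) = k"
  unfolding F_verts_def by (cases i) auto

lemma Union_F_verts: "(\<Union>i\<in>{1..m}. F_verts n k i) = {B_b n k <.. B_b n k + m * k}"
proof (induction m)
  case (Suc m)
  have "{1..Suc m} = insert (Suc m) {1..m}" by auto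
  then have "(\<Union>i\<in>{1..Suc m}. F_verts n k i) = F_verts n k (Suc m) \<union> {B_b n k <.. B_b n k + m * k}"
    using Suc by simp
  also have "\<dots> = {B_b n k <.. B_b n k + Suc m * k}" unfolding F_verts_def by auto
  finally show ?case .
qed simp

lemma pverts_B_graph: "pverts (B_graph n k) = {1..n}"
proof (cases "n \<le> k")
  case False
  then show ?thesis using B_bounds(2)[where n = n and k = k] unfolding B_graph_def Union_F_verts by auto
qed (simp add: B_graph_def path_graph_def)

lemma adj_path_graph:
  "adj (path_graph m) i j \<longleftrightarrow> i \<in> {1..m} \<and> j \<in> {1..m} \<and> (j = i + 1 \<or> i = j + 1)"
  unfolding path_graph_def by simp

lemma adj_B_graph:
  assumes "k < n"
  shows "adj (B_graph n k) u v \<longleftrightarrow> adj (path_graph (B_b n k)) u v \<or>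
    (\<exists>i\<in>{1..B_a n k}. u \<in> F_verts n k i \<and> v \<in> F_verts n k i \<and> u \<noteq> v \<or>
       u = i \<and> v \<in> F_verts n k i \<or> u \<in> F_verts n k i \<and> v = i)"
  using assms unfolding B_graph_def by auto

lemma pair_graphI:
  assumes "finite (pverts G)" "\<And>x y. adj G x y \<Longrightarrow> x \<in> pverts G \<and> x \<noteq> y \<and> adj G y x"
  shows "pair_graph G"
proof -
  have "parcs G \<subseteq> pverts G \<times> pverts G" using assms(2) by auto
  then have "finite (parcs G)" using assms(1) finite_subset by blast
  moreover have "symmetric (with_proj G)" unfolding symmetric_def sym_def using assms(2) by simp
  ultimately show ?thesis
    by unfold_locales (use assms in \<open>auto dest: assms(2)\<close>)
qed

lemma pair_graph_B_graph: "pair_graph (B_graph n k)"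
proof (rule pair_graphI)
  show "finite (pverts (B_graph n k))" by (simp add: pverts_B_graph)
  fix x y assume xy: "adj (B_graph n k) x y"
  show "x \<in> pverts (B_graph n k) \<and> x \<noteq> y \<and> adj (B_graph n k) y x"
  proof (cases "n \<le> k")
    case True
    then show ?thesis using xy unfolding B_graph_def path_graph_def by auto
  next
    case False
    then have kn: "k < n" by simp
    \<comment> \<open>Attaching vertices are at most \<open>B_b n k\<close> and block vertices
      exceed it, which excludes loops between them.\<close>
    have le: "i \<le> B_b n k" if "i \<in> {1..B_a n k}" for i using that B_bounds(1)[of n k] by simp
    have ne: "i \<noteq> w" if "i \<in> {1..B_a n k}" "w \<in> F_verts n k i" for i w
      using le[OF that(1)] F_verts_gt[OF that(2)] by simp
    have F: "F_verts n k i \<subseteq> pverts (B_graph n k)" if "i \<in> {1..B_a n k}" for i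
      using that kn unfolding B_graph_def by auto
    have "adj (B_graph n k) y x" using xy unfolding adj_B_graph[OF kn] adj_path_graph by blast
    moreover have "x \<noteq> y" using xy ne unfolding adj_B_graph[OF kn] adj_path_graph by fastforce
    moreover have "x \<in> pverts (B_graph n k)"
      using xy F le B_bounds(2)[of n k] unfolding adj_B_graph[OF kn] adj_path_graph
      by (fastforce simp: pverts_B_graph)
    ultimately show ?thesis by simp
  qed
qed

lemma (in adjacency) conn_path:
  fixes p :: "nat \<Rightarrow> 'a"
  assumes "m \<ge> 1" "\<And>i. 1 \<le> i \<Longrightarrow> i < m \<Longrightarrow> E (p i) (p (i + 1))"
  shows "conn (p ` {1..m})"
  using assms
proof (induction m rule: nat_induct_at_least)
  case base
  then show ?case using conn_singleton by simp
next
  case (Suc m)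
  have "conn (p ` {1..m} \<union> {p (Suc m)})"
    by (rule conn_Un[OF _ conn_singleton, of _ "p m"]) (use Suc in auto)
  moreover have "p ` {1..m} \<union> {p (Suc m)} = p ` {1..Suc m}" by (simp add: atLeastAtMostSuc_conv)
  ultimately show ?case by simp
qed

lemma connected_B_graph:
  assumes "k \<ge> 1" "n \<ge> 1"
  shows "Digraph_Component.connected (with_proj (B_graph n k))"
proof -
  interpret adjacency "adj (B_graph n k)" by (rule pair_graph_adjacency[OF pair_graph_B_graph])
  have "conn {1..n}"
  proof (cases "n \<le> k")
    case True
    have "conn ((\<lambda>i. i) ` {1..n})"
      by (rule conn_path) (use True assms in \<open>auto simp: B_graph_def path_graph_def\<close>)
    then show ?thesis by simp
  next
    case False
    then have kn: "k < n" by simp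
    have "0 < B_a n k" using kn unfolding B_a_def by (simp add: div_greater_zero_iff)
    then have b1: "B_b n k \<ge> 1" using B_bounds(1)[of n k] by simp
    have "conn ((\<lambda>i. i) ` {1..B_b n k})"
      by (rule conn_path) (use b1 in \<open>auto simp: adj_B_graph[OF kn] adj_path_graph\<close>)
    then have "conn ({1..B_b n k} \<union> \<Union>(F_verts n k ` {1..B_a n k}))"
    proof (intro conn_attach)
      fix B assume "B \<in> F_verts n k ` {1..B_a n k}"
      then obtain i where i: "i \<in> {1..B_a n k}" "B = F_verts n k i" by blast
      have "card B = k" using card_F_verts i by simp
      then obtain w where w: "w \<in> B" using assms(1) by fastforce
      have "conn B" by (rule conn_clique) (use w i in \<open>auto simp: adj_B_graph[OF kn]\<close>)
      moreover have "adj (B_graph n k) i w" unfolding adj_B_graph[OF kn] using i w by blast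
      moreover have "i \<in> {1..B_b n k}" using i(1) B_bounds(1)[of n k] by simp
      ultimately show "conn B \<and> (\<exists>a\<in>{1..B_b n k}. \<exists>b\<in>B. adj (B_graph n k) a b)" using w by blast
    qed auto
    moreover have "{1..B_b n k} \<union> \<Union>(F_verts n k ` {1..B_a n k}) = {1..n}"
      using pverts_B_graph[of n k] kn unfolding B_graph_def by simp
    ultimately show ?thesis by simp
  qed
  then show ?thesis using connected_iff_conn[OF pair_graph_B_graph] by (simp add: pverts_B_graph)
qed

section \<open>Admissibility and lower bound for the extremal graphs\<close>

lemma B_graph_not_complete:
  assumes "n \<ge> 3"
  shows "\<not> complete_digraph k (with_proj (B_graph n k))"
proof
  assume c: "complete_digraph k (with_proj (B_graph n k))"
  then have kn: "k = n"
    and arcs: "parcs (B_graph n k) = {(u, v). (u, v) \<in> {1..n} \<times> {1..n} \<and> u \<noteq> v}"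
    unfolding complete_digraph_pair_def pverts_B_graph by auto
  have "adj (B_graph n k) 1 3" unfolding arcs using assms by simp
  \<comment> \<open>As \<open>n = k\<close>, the graph is by definition a path, in which 1 and 3 are
    not adjacent.\<close>
  moreover have "\<not> adj (B_graph n k) 1 3" using kn by (simp add: B_graph_def path_graph_def)
  ultimately show False by blast
qed

lemma B_graph_not_C5:
  assumes "n \<ge> 3" "k = 2"
  shows "\<not> digraph_iso (with_proj (B_graph n k)) (with_proj C5)"
proof -
  have kn: "k < n" using assms by simp
  then have "0 < B_a n k" unfolding B_a_def by (simp add: div_greater_zero_iff)
  then have "1 \<in> {1..B_a n k}" by simp
  moreover have "B_b n k + 1 \<in> F_verts n k 1" "B_b n k + 2 \<in> F_verts n k 1"
    unfolding F_verts_def using assms by auto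
  ultimately have "adj (B_graph n k) 1 (B_b n k + 1)" "adj (B_graph n k) (B_b n k + 1) (B_b n k + 2)"
    "adj (B_graph n k) 1 (B_b n k + 2)"
    unfolding adj_B_graph[OF kn] by fastforce+
  then show ?thesis by (rule not_C5_if_triangle)
qed

lemma iota_B_graph_ge:
  assumes "k \<ge> 1"
  shows "B_a n k \<le> iota (with_proj (B_graph n k)) k"
proof (cases "n \<le> k")
  case True
  then show ?thesis unfolding B_a_def by simp
next
  case False
  then have kn: "k < n" by simp
  interpret adjacency "adj (B_graph n k)" by (rule pair_graph_adjacency[OF pair_graph_B_graph])
  obtain D where D: "clique_isolating k (with_proj (B_graph n k)) D"
    "card D = iota (with_proj (B_graph n k)) k"
    using iota_attained[OF pair_graph_B_graph assms] by blast
  have Dfree: "D \<subseteq> {1..n}" "clique_free k ({1..n} - nb D)"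
    using D(1) unfolding clique_isolating_iff[OF pair_graph_B_graph] pverts_B_graph by auto
  \<comment> \<open>A vertex of block \<open>i\<close> has neighbours only in its own block and at
    \<open>i\<close>, because it exceeds all path vertices and the blocks are disjoint.\<close>
  have nbF: "u \<in> insert i (F_verts n k i)" if "adj (B_graph n k) u w" "i \<in> {1..B_a n k}" "w \<in> F_verts n k i" for u w i
  proof -
    have "B_b n k < w" by (rule F_verts_gt) fact
    then have "\<not> adj (path_graph (B_b n k)) u w" unfolding adj_path_graph by simp
    then obtain j where j: "j \<in> {1..B_a n k}" "u \<in> F_verts n k j \<and> w \<in> F_verts n k j \<or>
       u = j \<and> w \<in> F_verts n k j \<or> u \<in> F_verts n k j \<and> w = j"
      using \<open>adj (B_graph n k) u w\<close> unfolding adj_B_graph[OF kn] by blast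
    moreover have "w \<noteq> j" using \<open>B_b n k < w\<close> j(1) B_bounds(1)[of n k] by auto
    ultimately have "w \<in> F_verts n k j" "u \<in> insert j (F_verts n k j)" by auto
    moreover from this have "j = i" using F_verts_disjoint[of w n k j i] j(1) that by simp
    ultimately show ?thesis by simp
  qed
  have "\<exists>d\<in>D. d \<in> insert i (F_verts n k i)" if i: "i \<in> {1..B_a n k}" for i
  proof (rule ccontr)
    assume none: "\<not> (\<exists>d\<in>D. d \<in> insert i (F_verts n k i))"
    have "F_verts n k i \<inter> nb D = {}" using none nbF[OF _ i] unfolding nb_def by blast
    moreover have "F_verts n k i \<subseteq> {1..n}"
      using i kn pverts_B_graph[of n k] unfolding B_graph_def by auto
    moreover have "clique k (F_verts n k i)"
      unfolding clique_def
    proof (intro conjI ballI impI)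
      show "finite (F_verts n k i)" by (simp add: F_verts_def)
      show "card (F_verts n k i) = k" using card_F_verts i by simp
    qed (use i in \<open>auto simp: adj_B_graph[OF kn]\<close>)
    ultimately show False using Dfree(2) unfolding clique_free_def by blast
  qed
  then obtain d where d: "\<And>i. i \<in> {1..B_a n k} \<Longrightarrow> d i \<in> D \<and> d i \<in> insert i (F_verts n k i)" by metis
  \<comment> \<open>The values are told apart by position: path vertices are at most
    \<open>B_b n k\<close>, and block vertices lie above it in disjoint blocks.\<close>
  have "inj_on d {1..B_a n k}"
  proof (rule inj_onI)
    fix i j assume ij: "i \<in> {1..B_a n k}" "j \<in> {1..B_a n k}" "d i = d j"
    have "i \<le> B_b n k" "j \<le> B_b n k" using ij B_bounds(1)[of n k] by auto
    then show "i = j"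
      using d[OF ij(1)] d[OF ij(2)] ij F_verts_gt[of "d i" n k i] F_verts_gt[of "d j" n k j]
        F_verts_disjoint[of "d i" n k i j] by auto
  qed
  moreover have "d ` {1..B_a n k} \<subseteq> D" using d by blast
  moreover have "finite D" using Dfree(1) finite_subset by blast
  ultimately have "card {1..B_a n k} \<le> card D" by (rule card_inj_on_le)
  then show ?thesis using D(2) by simp
qed

theorem theorem1p1:
  shows "(\<forall>(k::nat) (n::nat) (G :: 'a pair_pre_digraph).
            k \<ge> 1 \<longrightarrow> pair_graph G \<longrightarrow> Digraph_Component.connected (with_proj G) \<longrightarrow>
            card (pverts G) = n \<longrightarrow>
            \<not> complete_digraph k (with_proj G) \<longrightarrow>
            \<not> (k = 2 \<and> digraph_iso (with_proj G) (with_proj C5)) \<longrightarrow>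
            real (iota (with_proj G) k) \<le> real n / real (k + 1))
       \<and> (\<forall>(k::nat) (n::nat). k \<ge> 1 \<longrightarrow> n \<ge> 3 \<longrightarrow>
            iota_max n k = iota (with_proj (B_graph n k)) k \<and>
            int (iota (with_proj (B_graph n k)) k) = \<lfloor>real n / real (k + 1)\<rfloor>)"
proof (intro conjI allI impI)
  fix k n :: nat and G :: "'a pair_pre_digraph"
  assume "k \<ge> 1" "pair_graph G" "Digraph_Component.connected (with_proj G)" "card (pverts G) = n"
    "\<not> complete_digraph k (with_proj G)" "\<not> (k = 2 \<and> digraph_iso (with_proj G) (with_proj C5))"
  then have "(k + 1) * iota (with_proj G) k \<le> n" using iota_le by blast
  then have "real (k + 1) * real (iota (with_proj G) k) \<le> real n"
    unfolding of_nat_mult[symmetric] of_nat_le_iff .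
  then show "real (iota (with_proj G) k) \<le> real n / real (k + 1)"
    by (simp add: pos_le_divide_eq mult.commute)
next
  fix k n :: nat assume k: "k \<ge> 1" and n: "n \<ge> 3"
  have le: "iota (with_proj G) k \<le> B_a n k"
    if "pair_graph G" "pverts G = {1..n}" "Digraph_Component.connected (with_proj G)"
      "\<not> complete_digraph k (with_proj G)" "\<not> (k = 2 \<and> digraph_iso (with_proj G) (with_proj C5))"
    for G :: "nat pair_pre_digraph"
  proof -
    have "(k + 1) * iota (with_proj G) k \<le> n" using iota_le[OF that(1) k that(3-5)] that(2) by simp
    then show ?thesis unfolding B_a_def by (simp add: less_eq_div_iff_mult_less_eq mult.commute)
  qed
  note B = pair_graph_B_graph pverts_B_graph connected_B_graph[OF k, of n] B_graph_not_complete[OF n]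
  have B': "\<not> (k = 2 \<and> digraph_iso (with_proj (B_graph n k)) (with_proj C5))"
    using B_graph_not_C5[OF n] by blast
  have eq: "iota (with_proj (B_graph n k)) k = B_a n k"
    using le[OF B(1,2) _ B(4) B'] B(3) n iota_B_graph_ge[OF k, of n] by fastforce
  then show "int (iota (with_proj (B_graph n k)) k) = \<lfloor>real n / real (k + 1)\<rfloor>"
    unfolding B_a_def by (simp only: floor_divide_of_nat_eq)
  show "iota_max n k = iota (with_proj (B_graph n k)) k"
    unfolding iota_max_def
  proof (rule Max_eqI)
    let ?I = "{iota (with_proj G) k |G :: nat pair_pre_digraph.
      pair_graph G \<and> pverts G = {1..n} \<and> Digraph_Component.connected (with_proj G) \<and>
      \<not> complete_digraph k (with_proj G) \<and> \<not> (k = 2 \<and> digraph_iso (with_proj G) (with_proj C5))}"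
    \<comment> \<open>The upper bound also makes the set of values finite, so that
      \<open>Max\<close> is meaningful.\<close>
    have "?I \<subseteq> {..B_a n k}" using le by auto
    then show "finite ?I" using finite_subset by blast
    show "m \<le> iota (with_proj (B_graph n k)) k" if "m \<in> ?I" for m
      using that le unfolding eq by blast
    show "iota (with_proj (B_graph n k)) k \<in> ?I"
      using B B' n by fastforce
  qed
qed

end
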